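(* Suppose that each group $G_k$, $k\in\mathbb{N}$, is finite. Then $\mathcal{H}_\mu^{\mathrm{det}}=\mathcal{H}_\mu^{\mathrm{freeze}}=\mathcal{G}$ if and only if for some (equivalently, all) $\mathbb{P}\in\mathcal{P}_\mu$ there are constants $c_{k,m}\in G_k$, $k,m\in\mathbb{N}$, $k\le m$, such that $$\mathbb{P}\{\phi_k^m(Z_m)\neq c_{k,m}\ \text{for infinitely many } m\}=0$$ for all $k\in\mathbb{N}$.
   Context: $\mathbb{N}=\{1,2,\dots\}$. Let $(G_k)_{k\in\mathbb{N}}$ be a sequence of compact Hausdorff groups with countable bases, with identities $e_k$, let $\phi_k:G_{k+1}\to G_k$ be a continuous homomorphism for each $k$, and let $G:=\prod_{k\in\mathbb{N}}G_k$ with the product topology. For $k<\ell$ put $\phi_k^\ell:=\phi_k\circ\phi_{k+1}\circ\cdots\circ\phi_{\ell-1}:G_\ell\to G_k$, and let $\phi_k^k$ be the identity map of $G_k$. Let $\mu=(\mu_k)_{k\in\mathbb{N}}$, where $\mu_k$ is a Borel probability measure on $G_k$. Let $X_k:G\to G_k$ be the $k$-th coordinate map and $Z_k:=\phi_k(X_{k+1})^{-1}X_k$. The set $\mathcal{P}_\mu$ of solutions of the stochastic equation associated with $\mu$ is the set of Borel probability measures $\mathbb{P}$ on $G$ such that for every $k\in\mathbb{N}$ and every bounded Borel $f:G_k\to\mathbb{R}$, the conditional expectation of $f(X_k)$ given $(X_j)_{j>k}$ under $\mathbb{P}$ equals $\int_{G_k}f(\phi_k(X_{k+1})z)\,\mu_k(dz)$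 $\mathbb{P}$-a.s.; equivalently, for every $k$, under $\mathbb{P}$ the variable $Z_k$ has distribution $\mu_k$ and is independent of $(X_j)_{j>k}$. $\mathcal{G}$ is the set of all (continuous) unitary, finite-dimensional representations of $G$; $d(\rho)$ is the dimension of $\rho\in\mathcal{G}$. For $k\in\mathbb{N}$, $\iota_k:G_k\to G$ sends $h$ to $(e_1,\dots,e_{k-1},h,e_{k+1},\dots)$. For $\rho\in\mathcal{G}$ and $k\le\ell$ set $R_k^\ell:=\int_{G_\ell}\rho\circ\iota_k\circ\phi_k^\ell(z)\,\mu_\ell(dz)$ (depending on $\rho$). Define $$\mathcal{H}_\mu^{\mathrm{det}}:=\{\rho\in\mathcal{G}:\lim_{m\to\infty}\lim_{n\to\infty}|\det(R_k^nR_k^{n-1}\cdots R_k^m)|>0\ \ \forall k\in\mathbb{N}\},$$ $$\mathcal{H}_\mu^{\mathrm{freeze}}:=\Big\{\rho\in\mathcal{G}:\sum_{m=k}^\infty\big[d(\rho)-\|R_k^m\|_{HS}^2\big]<\infty\ \ \forall k\in\mathbb{N}\Big\},$$ where $\|A\|_{HS}:=\operatorname{tr}(A^*A)^{1/2}$ is the Hilbert–Schmidt norm. *)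

theory Defs
  imports
    "HOL-Probability.Probability"
    "HOL-Algebra.Product_Groups"
    "Jordan_Normal_Form.Schur_Decomposition"
begin

text \<open>Sequences are indexed by the type \<open>nat\<close>, i.e. from 0 instead of 1; only the order of the
  indices matters. All groups of a sequence have carriers in one type \<open>'a\<close>. A topological group
  is a pair of a group and an abstract topology on its carrier.\<close>

definition topological_group :: "('a, 'b) monoid_scheme \<Rightarrow> 'a topology \<Rightarrow> bool" where
  "topological_group G T \<longleftrightarrow>
     group G \<and> topspace T = carrier G \<and>
     continuous_map (prod_topology T T) T (\<lambda>(x, y). x \<otimes>\<^bsub>G\<^esub> y) \<and>
     continuous_map T T (\<lambda>x. inv\<^bsub>G\<^esub> x)"

definition borel_of :: "'a topology \<Rightarrow> 'a measure" where
  "borel_of T = sigma (topspace T) {U. openin T U}"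

definition borel_prob_on :: "'a topology \<Rightarrow> 'a measure \<Rightarrow> bool" where
  "borel_prob_on T M \<longleftrightarrow> prob_space M \<and> sets M = sets (borel_of T)"

locale compact_group_chain =
  fixes G :: "nat \<Rightarrow> 'a monoid"
    and T :: "nat \<Rightarrow> 'a topology"
    and \<phi> :: "nat \<Rightarrow> 'a \<Rightarrow> 'a"
    and \<mu> :: "nat \<Rightarrow> 'a measure"
  assumes topological_group: "topological_group (G k) (T k)"
    and compact: "compact_space (T k)"
    and Hausdorff: "Hausdorff_space (T k)"
    and countable_base: "second_countable (T k)"
    and hom: "\<phi> k \<in> hom (G (Suc k)) (G k)"
    and continuous: "continuous_map (T (Suc k)) (T k) (\<phi> k)"
    and noise: "borel_prob_on (T k) (\<mu> k)"

text \<open>\<open>phi_comp \<phi> k l\<close> is \<open>\<phi> k \<circ> \<dots> \<circ> \<phi> (l - 1)\<close>; it is only meaningful for \<open>k \<le> l\<close>.\<close>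

definition phi_comp :: "(nat \<Rightarrow> 'a \<Rightarrow> 'a) \<Rightarrow> nat \<Rightarrow> nat \<Rightarrow> 'a \<Rightarrow> 'a" where
  "phi_comp \<phi> k l = foldr (\<circ>) (map \<phi> [k..<l]) id"

definition Z :: "(nat \<Rightarrow> 'a monoid) \<Rightarrow> (nat \<Rightarrow> 'a \<Rightarrow> 'a) \<Rightarrow> nat \<Rightarrow> (nat \<Rightarrow> 'a) \<Rightarrow> 'a" where
  "Z G \<phi> k x = inv\<^bsub>G k\<^esub> (\<phi> k (x (Suc k))) \<otimes>\<^bsub>G k\<^esub> x k"

text \<open>The sigma-algebra on the product space generated by the coordinates of index greater than \<open>k\<close>.\<close>

definition tail_sigma :: "(nat \<Rightarrow> 'a topology) \<Rightarrow> nat \<Rightarrow> (nat \<Rightarrow> 'a) measure" where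
  "tail_sigma T k = (let \<Omega> = topspace (product_topology T UNIV) in
     sigma \<Omega> {(\<lambda>x. x j) -` A \<inter> \<Omega> | j A. j > k \<and> A \<in> sets (borel_of (T j))})"

definition solutions ::
  "(nat \<Rightarrow> 'a monoid) \<Rightarrow> (nat \<Rightarrow> 'a topology) \<Rightarrow> (nat \<Rightarrow> 'a \<Rightarrow> 'a) \<Rightarrow> (nat \<Rightarrow> 'a measure) \<Rightarrow>
   (nat \<Rightarrow> 'a) measure set" where
  "solutions G T \<phi> \<mu> = {P. borel_prob_on (product_topology T UNIV) P \<and>
     (\<forall>k. \<forall>f :: 'a \<Rightarrow> real.
        f \<in> borel_measurable (borel_of (T k)) \<longrightarrow> bounded (f ` carrier (G k)) \<longrightarrow>
        (AE x in P. real_cond_exp P (tail_sigma T k) (\<lambda>x. f (x k)) x =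
                    (\<integral>z. f (\<phi> k (x (Suc k)) \<otimes>\<^bsub>G k\<^esub> z) \<partial>\<mu> k)))}"

definition unitary_group :: "nat \<Rightarrow> complex mat monoid" where
  "unitary_group d = \<lparr>carrier = {U \<in> carrier_mat d d. mat_adjoint U * U = 1\<^sub>m d \<and> U * mat_adjoint U = 1\<^sub>m d},
     monoid.mult = (*), one = 1\<^sub>m d\<rparr>"

text \<open>Representations are extensional functions, so that equality of sets of representations
  does not depend on values outside the product group. Continuity is entrywise.\<close>

definition reps ::
  "(nat \<Rightarrow> 'a monoid) \<Rightarrow> (nat \<Rightarrow> 'a topology) \<Rightarrow> ((nat \<Rightarrow> 'a) \<Rightarrow> complex mat) set" where
  "reps G T = {\<rho>. \<rho> \<in> extensional (carrier (product_group UNIV G)) \<and>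
     (\<exists>d. \<rho> \<in> hom (product_group UNIV G) (unitary_group d) \<and>
        (\<forall>i<d. \<forall>j<d. continuous_map (product_topology T UNIV) euclidean (\<lambda>x. \<rho> x $$ (i, j))))}"

definition rep_dim :: "(nat \<Rightarrow> 'a monoid) \<Rightarrow> ((nat \<Rightarrow> 'a) \<Rightarrow> complex mat) \<Rightarrow> nat" where
  "rep_dim G \<rho> = dim_row (\<rho> \<one>\<^bsub>product_group UNIV G\<^esub>)"

definition \<iota> :: "(nat \<Rightarrow> 'a monoid) \<Rightarrow> nat \<Rightarrow> 'a \<Rightarrow> nat \<Rightarrow> 'a" where
  "\<iota> G k h = (\<lambda>j. if j = k then h else \<one>\<^bsub>G j\<^esub>)"

definition R ::
  "(nat \<Rightarrow> 'a monoid) \<Rightarrow> (nat \<Rightarrow> 'a \<Rightarrow> 'a) \<Rightarrow> (nat \<Rightarrow> 'a measure) \<Rightarrow>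
   ((nat \<Rightarrow> 'a) \<Rightarrow> complex mat) \<Rightarrow> nat \<Rightarrow> nat \<Rightarrow> complex mat" where
  "R G \<phi> \<mu> \<rho> k l = mat (rep_dim G \<rho>) (rep_dim G \<rho>)
     (\<lambda>(i, j). \<integral>z. \<rho> (\<iota> G k (phi_comp \<phi> k l z)) $$ (i, j) \<partial>\<mu> l)"

text \<open>\<open>R_prod G \<phi> \<mu> \<rho> k m n\<close> is \<open>R k n * R k (n - 1) * \<dots> * R k m\<close> (the remaining arguments
  of \<open>R\<close> suppressed), for \<open>m \<le> n\<close>.\<close>

definition R_prod ::
  "(nat \<Rightarrow> 'a monoid) \<Rightarrow> (nat \<Rightarrow> 'a \<Rightarrow> 'a) \<Rightarrow> (nat \<Rightarrow> 'a measure) \<Rightarrow>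
   ((nat \<Rightarrow> 'a) \<Rightarrow> complex mat) \<Rightarrow> nat \<Rightarrow> nat \<Rightarrow> nat \<Rightarrow> complex mat" where
  "R_prod G \<phi> \<mu> \<rho> k m n =
     foldr (*) (map (R G \<phi> \<mu> \<rho> k) (rev [m..<Suc n])) (1\<^sub>m (rep_dim G \<rho>))"

text \<open>Both limits exist for every representation, since the matrices \<open>R\<close> are contractions.\<close>

definition H_det ::
  "(nat \<Rightarrow> 'a monoid) \<Rightarrow> (nat \<Rightarrow> 'a topology) \<Rightarrow> (nat \<Rightarrow> 'a \<Rightarrow> 'a) \<Rightarrow> (nat \<Rightarrow> 'a measure) \<Rightarrow>
   ((nat \<Rightarrow> 'a) \<Rightarrow> complex mat) set" where
  "H_det G T \<phi> \<mu> = {\<rho> \<in> reps G T. \<forall>k. \<exists>L l.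
     (\<forall>m\<ge>k. (\<lambda>n. cmod (Determinant.det (R_prod G \<phi> \<mu> \<rho> k m n))) \<longlonglongrightarrow> L m) \<and>
     L \<longlonglongrightarrow> l \<and> l > (0 :: real)}"

definition hs_norm :: "complex mat \<Rightarrow> real" where
  "hs_norm A = (let B = mat_adjoint A * A in sqrt (Re (\<Sum>i<dim_row B. B $$ (i, i))))"

text \<open>The summands below are nonnegative, so finiteness of the sum is summability.\<close>

definition H_freeze ::
  "(nat \<Rightarrow> 'a monoid) \<Rightarrow> (nat \<Rightarrow> 'a topology) \<Rightarrow> (nat \<Rightarrow> 'a \<Rightarrow> 'a) \<Rightarrow> (nat \<Rightarrow> 'a measure) \<Rightarrow>
   ((nat \<Rightarrow> 'a) \<Rightarrow> complex mat) set" where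
  "H_freeze G T \<phi> \<mu> = {\<rho> \<in> reps G T. \<forall>k.
     summable (\<lambda>j. real (rep_dim G \<rho>) - (hs_norm (R G \<phi> \<mu> \<rho> k (k + j)))\<^sup>2)}"

text \<open>Membership in \<open>null_sets P\<close> says that the event is measurable and has probability 0.\<close>

definition eventually_frozen ::
  "(nat \<Rightarrow> 'a monoid) \<Rightarrow> (nat \<Rightarrow> 'a \<Rightarrow> 'a) \<Rightarrow> (nat \<Rightarrow> 'a) measure \<Rightarrow> bool" where
  "eventually_frozen G \<phi> P \<longleftrightarrow>
     (\<exists>c :: nat \<Rightarrow> nat \<Rightarrow> 'a. (\<forall>k m. k \<le> m \<longrightarrow> c k m \<in> carrier (G k)) \<and>
        (\<forall>k. {x \<in> space P. \<exists>\<^sub>\<infinity>m. k \<le> m \<and> phi_comp \<phi> k m (Z G \<phi> m x) \<noteq> c k m} \<in> null_sets P))"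

end

theory Submission
  imports Defs
begin

text \<open>
  In a solution the noise variables \<open>Z m\<close> are independent with laws \<open>\<mu> m\<close>. For fixed \<open>k\<close> the
  events \<open>\<phi>\<^sub>k\<^sup>m (Z m) \<noteq> c k m\<close> are therefore independent, and both Borel--Cantelli
  lemmas show that almost surely only finitely many of them occur exactly if their probabilities
  are summable. This is a condition on the pushed-forward laws of \<open>\<mu> m\<close> on \<open>G k\<close> alone: their mass
  outside one point \<open>c k m\<close> must be summable over \<open>m\<close> (\<open>noise_concentrates\<close>). Hence all solutions
  freeze as soon as one of them does (\<open>eventually_frozen_iff\<close>). The remaining point is that a
  solution exists: the equation is a backward recursion, so solutions up to a finite horizon
  are trivial, consistent one-dimensional marginals for all times come from compactness, and
  reversing time gives a Markov chain that starts at index 0 (\<open>solutions_nonempty\<close>).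

  On the other side, \<open>R k m\<close> is an average of the unitary matrices \<open>\<rho> (\<iota> k g)\<close> with weights the
  pushed-forward law on \<open>G k\<close>. If all but a mass \<open>\<epsilon>\<close> of the weight sits at one group element,
  then \<open>R k m\<close> is within \<open>O(\<epsilon>)\<close> of a unitary matrix and \<open>d - \<parallel>R k m\<parallel>\<^sup>2 = O(\<epsilon>)\<close>
  (\<open>avg_hs_defect\<close>), so concentration makes the freezing series converge for every
  representation. Conversely the regular representation of \<open>G k\<close>, for which
  \<open>d - \<parallel>R k m\<parallel>\<^sup>2 = d (1 - \<Sum>\<^sub>g w(g)\<^sup>2)\<close> with \<open>w\<close> the weights, recovers concentration at a
  most likely point (\<open>freeze_imp_concentrates\<close>).

  The determinant condition follows from the freezing condition: the squared singular values of the contraction \<open>R k m\<close>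
  lie in the unit interval, their sum is \<open>\<parallel>R k m\<parallel>\<^sup>2\<close> and their product is \<open>|det (R k m)|\<^sup>2\<close>, whence
  \<open>1 - |det (R k m)| \<le> d - \<parallel>R k m\<parallel>\<^sup>2\<close> (\<open>contraction_det_hs\<close>). Summability of the right-hand side makes
  the tail products of the determinants tend to 1 (\<open>H_freeze_subset_H_det\<close>).
\<close>

(* The same sign selects entries of vectors of fixed length; only vectors of variable length occur below. *)
no_notation Finite_Cartesian_Product.vec_nth (infixl \<open>$\<close> 90)

section \<open>Determinant and Hilbert--Schmidt norm of a contraction\<close>

lemma cmod_square: "(complex_of_real (cmod z))\<^sup>2 = z * cnj z"
  by (metis complex_norm_square of_real_power)

definition sqnorm :: "complex vec \<Rightarrow> real" where
  "sqnorm v = (\<Sum>i<dim_vec v. (cmod (v $ i))\<^sup>2)"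

lemma mat_adjoint_dim [simp]:
  "dim_row (mat_adjoint A) = dim_col A" "dim_col (mat_adjoint A) = dim_row A"
  by (auto simp: mat_adjoint_def)

lemma mat_adjoint_carrier [simp]: "A \<in> carrier_mat d d \<Longrightarrow> mat_adjoint A \<in> carrier_mat d d"
  by (auto simp: mat_adjoint_def)

lemma mat_adjoint_index:
  "A \<in> carrier_mat d d \<Longrightarrow> i < d \<Longrightarrow> j < d \<Longrightarrow> mat_adjoint A $$ (i, j) = cnj (A $$ (j, i))" for A :: "complex mat"
  by (auto simp: mat_adjoint_def mat_of_rows_index)

lemma mult_index_sum:
  "A \<in> carrier_mat d d \<Longrightarrow> B \<in> carrier_mat d d \<Longrightarrow> i < d \<Longrightarrow> j < d \<Longrightarrow>
     (A * B) $$ (i, j) = (\<Sum>l<d. A $$ (i, l) * B $$ (l, j))"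
  by (auto simp: scalar_prod_def atLeast0LessThan)

lemma gram_index:
  "A \<in> carrier_mat d d \<Longrightarrow> i < d \<Longrightarrow> j < d \<Longrightarrow>
     (mat_adjoint A * A) $$ (i, j) = (\<Sum>l<d. cnj (A $$ (l, i)) * A $$ (l, j))" for A :: "complex mat"
  by (simp add: mult_index_sum[of _ d] mat_adjoint_index del: index_mult_mat)

lemma mult_vec_index_sum:
  "A \<in> carrier_mat d d \<Longrightarrow> v \<in> carrier_vec d \<Longrightarrow> i < d \<Longrightarrow>
     (A *\<^sub>v v) $ i = (\<Sum>l<d. A $$ (i, l) * v $ l)"
  by (auto simp: scalar_prod_def atLeast0LessThan)

lemma gram_diag:
  assumes "A \<in> carrier_mat d d" "i < d"
  shows "(mat_adjoint A * A) $$ (i, i) = of_real (\<Sum>l<d. (cmod (A $$ (l, i)))\<^sup>2)"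
proof -
  have "cnj z * z = of_real ((cmod z)\<^sup>2)" for z
    by (metis complex_norm_square mult.commute)
  then show ?thesis by (simp add: gram_index[OF assms assms(2)])
qed

lemma hs_norm_square:
  assumes "A \<in> carrier_mat d d"
  shows "(hs_norm A)\<^sup>2 = (\<Sum>i<d. \<Sum>j<d. (cmod (A $$ (i, j)))\<^sup>2)"
proof -
  have "(\<Sum>i<d. (mat_adjoint A * A) $$ (i, i)) = complex_of_real (\<Sum>j<d. \<Sum>i<d. (cmod (A $$ (i, j)))\<^sup>2)" (is "_ = complex_of_real ?r")
    by (simp add: gram_diag[OF assms] del: index_mult_mat)
  then have "Re (\<Sum>i<d. (mat_adjoint A * A) $$ (i, i)) = ?r" by (simp only: Re_complex_of_real)
  then have "Re (\<Sum>i<dim_row (mat_adjoint A * A). (mat_adjoint A * A) $$ (i, i)) = (\<Sum>i<d. \<Sum>j<d. (cmod (A $$ (i, j)))\<^sup>2)"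
    using assms mat_adjoint_carrier[OF assms] sum.swap[of "\<lambda>i j. (cmod (A $$ (i, j)))\<^sup>2" "{..<d}" "{..<d}"]
    by (simp del: Re_sum index_mult_mat(1))
  then show ?thesis by (simp add: hs_norm_def Let_def sum_nonneg)
qed

lemma det_mat_adjoint:
  fixes A :: "complex mat"
  assumes "A \<in> carrier_mat d d"
  shows "Determinant.det (mat_adjoint A) = cnj (Determinant.det A)"
proof -
  interpret comm_ring_hom cnj by unfold_locales auto
  have "mat_adjoint A = transpose_mat (map_mat cnj A)"
    using assms mat_adjoint_carrier[OF assms] by (intro eq_matI) (auto simp: mat_adjoint_index)
  then show ?thesis using assms by (simp add: Determinant.det_transpose[of _ d])
qed

text \<open>In coordinates, \<open>|A v|\<^sup>2 = \<langle>v, A\<^sup>* A v\<rangle>\<close>: properties of the Gram matrix \<open>A\<^sup>* A\<close> become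
  properties of lengths.\<close>

lemma sqnorm_mult_vec:
  fixes A :: "complex mat"
  assumes A: "A \<in> carrier_mat d d" and v: "v \<in> carrier_vec d"
  shows "of_real (sqnorm (A *\<^sub>v v)) = (\<Sum>i<d. cnj (v $ i) * ((mat_adjoint A * A) *\<^sub>v v) $ i)"
proof -
  have B: "mat_adjoint A * A \<in> carrier_mat d d" using A by auto
  have "(\<Sum>i<d. cnj (v $ i) * ((mat_adjoint A * A) *\<^sub>v v) $ i) =
     (\<Sum>i<d. cnj (v $ i) * (\<Sum>j<d. (\<Sum>l<d. cnj (A $$ (l, i)) * A $$ (l, j)) * v $ j))"
    using v by (intro sum.cong refl)
      (simp add: mult_vec_index_sum[OF B] gram_index[OF A] del: index_mult_mat_vec index_mult_mat)
  also have "\<dots> = (\<Sum>i<d. \<Sum>j<d. \<Sum>l<d. cnj (A $$ (l, i) * v $ i) * (A $$ (l, j) * v $ j))"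
    by (simp add: sum_distrib_left sum_distrib_right mult_ac)
  also have "\<dots> = (\<Sum>i<d. \<Sum>l<d. \<Sum>j<d. cnj (A $$ (l, i) * v $ i) * (A $$ (l, j) * v $ j))"
    by (intro sum.cong refl sum.swap)
  also have "\<dots> = (\<Sum>l<d. \<Sum>i<d. \<Sum>j<d. cnj (A $$ (l, i) * v $ i) * (A $$ (l, j) * v $ j))"
    by (rule sum.swap)
  also have "\<dots> = (\<Sum>l<d. cnj ((A *\<^sub>v v) $ l) * (A *\<^sub>v v) $ l)"
    using A v by (intro sum.cong refl) (simp add: mult_vec_index_sum[OF A] sum_product del: index_mult_mat_vec)
  also have "\<dots> = of_real (sqnorm (A *\<^sub>v v))"
    using A v by (auto simp: sqnorm_def cmod_square mult.commute simp del: index_mult_mat_vec intro!: sum.cong)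
  finally show ?thesis by simp
qed

text \<open>The eigenvalue is the Rayleigh quotient \<open>|A v|\<^sup>2 / |v|\<^sup>2\<close> of its eigenvector \<open>v\<close>.\<close>

lemma gram_eigenvalue_contraction:
  fixes A :: "complex mat"
  assumes A: "A \<in> carrier_mat d d"
    and contr: "\<And>v. v \<in> carrier_vec d \<Longrightarrow> sqnorm (A *\<^sub>v v) \<le> sqnorm v"
    and ev: "eigenvalue (mat_adjoint A * A) e"
  shows "e \<in> of_real ` {0..1}"
proof -
  define B where "B = mat_adjoint A * A"
  have B: "B \<in> carrier_mat d d" using A by (auto simp: B_def)
  obtain v where "eigenvector B v e" using ev by (auto simp: eigenvalue_def B_def)
  then have v: "v \<in> carrier_vec d" "v \<noteq> 0\<^sub>v d" "B *\<^sub>v v = e \<cdot>\<^sub>v v"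
    using B by (auto simp: eigenvector_def)
  have sq: "of_real (sqnorm w) = (\<Sum>i<d. cnj (w $ i) * w $ i)" if "w \<in> carrier_vec d" for w :: "complex vec"
    using that unfolding sqnorm_def by (auto simp: cmod_square mult.commute intro!: sum.cong)
  have "e * of_real (sqnorm v) = (\<Sum>i<d. cnj (v $ i) * (B *\<^sub>v v) $ i)"
    using v by (simp add: sq sum_distrib_left mult_ac del: index_mult_mat_vec)
  also have "\<dots> = of_real (sqnorm (A *\<^sub>v v))"
    using sqnorm_mult_vec[OF A v(1)] by (simp add: B_def)
  finally have eq: "e * of_real (sqnorm v) = of_real (sqnorm (A *\<^sub>v v))" .
  obtain i where "i < d" "v $ i \<noteq> 0" using v by (metis carrier_vecD eq_vecI index_zero_vec)
  then have pos: "sqnorm v > 0" using v unfolding sqnorm_def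
    by (intro sum_pos2[of _ i]) auto
  have "e = of_real (sqnorm (A *\<^sub>v v) / sqnorm v)" using eq pos by (simp add: field_simps)
  moreover have "sqnorm (A *\<^sub>v v) \<ge> 0" by (simp add: sqnorm_def sum_nonneg)
  ultimately show ?thesis
    using contr[OF v(1)] pos by (intro image_eqI[of _ _ "sqnorm (A *\<^sub>v v) / sqnorm v"]) auto
qed

text \<open>Induction, with \<open>(1 - x) (1 - p) \<ge> 0\<close> for the new factor \<open>x\<close> and the old product \<open>p\<close>. The list
  form is the one in which eigenvalues come with their multiplicities.\<close>

lemma prod_list_ge_one_minus_defect:
  fixes xs :: "real list"
  assumes "set xs \<subseteq> {0..1}"
  shows "1 - (real (length xs) - sum_list xs) \<le> prod_list xs \<and> prod_list xs \<in> {0..1}"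
  using assms
proof (induction xs)
  case (Cons x xs)
  define p where "p = prod_list xs"
  define s where "s = real (length xs) - sum_list xs"
  have *: "p \<ge> 1 - s" "0 \<le> p" "p \<le> 1" "0 \<le> x" "x \<le> 1" using Cons by (auto simp: p_def s_def)
  then have "(1 - x) * (1 - p) \<ge> 0" by (intro mult_nonneg_nonneg) auto
  then have "x * p \<ge> 1 - (s + 1 - x)" using * by (simp add: algebra_simps)
  moreover have "0 \<le> x * p" "x * p \<le> 1" using * by (auto simp: mult_le_one)
  ultimately show ?case by (simp add: p_def s_def algebra_simps)
qed simp

lemma trace_mult_comm:
  fixes A B :: "'a :: comm_ring_1 mat"
  assumes "A \<in> carrier_mat d d" "B \<in> carrier_mat d d"
  shows "(\<Sum>i<d. (A * B) $$ (i, i)) = (\<Sum>i<d. (B * A) $$ (i, i))"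
proof -
  have "(\<Sum>i<d. (A * B) $$ (i, i)) = (\<Sum>i<d. \<Sum>l<d. A $$ (i, l) * B $$ (l, i))"
    using assms by (simp add: mult_index_sum[of _ d] del: index_mult_mat)
  also have "\<dots> = (\<Sum>l<d. \<Sum>i<d. B $$ (l, i) * A $$ (i, l))"
    by (subst sum.swap) (simp add: mult.commute)
  also have "\<dots> = (\<Sum>i<d. (B * A) $$ (i, i))"
    using assms by (simp add: mult_index_sum[of _ d] del: index_mult_mat)
  finally show ?thesis .
qed

text \<open>By the Schur decomposition \<open>A\<close> is similar to an upper triangular matrix whose diagonal lists the
  roots of the characteristic polynomial. Trace and determinant are invariant under similarity.\<close>

lemma trace_det_eigenvalues:
  fixes A :: "complex mat"
  assumes A: "A \<in> carrier_mat d d"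
  obtains es where "length es = d" "\<And>e. e \<in> set es \<Longrightarrow> eigenvalue A e"
    "Determinant.det A = prod_list es" "(\<Sum>i<d. A $$ (i, i)) = sum_list es"
proof -
  obtain es where es: "char_poly A = (\<Prod>a\<leftarrow>es. [:- a, 1:])" "length es = d"
    using char_poly_factorized[OF A] by blast
  obtain B P Q where sd: "schur_decomposition A es = (B, P, Q)" by (cases "schur_decomposition A es")
  from schur_decomposition[OF A es(1) sd]
  have w: "similar_mat_wit A B P Q" "upper_triangular B" "diag_mat B = es" by auto
  note W = similar_mat_witD2[OF A w(1)]
  have "eigenvalue A e" if "e \<in> set es" for e
  proof -
    have "poly (char_poly A) e = (\<Prod>a\<leftarrow>es. e - a)" unfolding es(1)
      by (induction es) (auto simp: algebra_simps)
    also have "\<dots> = 0" using that by (auto simp: prod_list_zero_iff)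
    finally show ?thesis by (simp add: eigenvalue_root_char_poly[OF A])
  qed
  moreover have "Determinant.det A = prod_list es"
    using det_similar[of A B] w W det_upper_triangular[OF w(2) W(5)] by (auto simp: similar_mat_def)
  moreover have "(\<Sum>i<d. A $$ (i, i)) = sum_list es"
  proof -
    have "(\<Sum>i<d. A $$ (i, i)) = (\<Sum>i<d. (P * (B * Q)) $$ (i, i))"
      using W by (simp add: assoc_mult_mat[of _ d d _ d _ d] del: index_mult_mat)
    also have "\<dots> = (\<Sum>i<d. (B * Q * P) $$ (i, i))"
      using W by (intro trace_mult_comm) auto
    also have "B * Q * P = B" using W by (simp add: assoc_mult_mat[of _ d d _ d _ d])
    also have "(\<Sum>i<d. B $$ (i, i)) = sum_list (diag_mat B)"
      using W by (simp add: diag_mat_def sum_list_distinct_conv_sum_set atLeast0LessThan)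
    finally show ?thesis by (simp add: w)
  qed
  ultimately show thesis using that es(2) by blast
qed

text \<open>The eigenvalues of \<open>A\<^sup>* A\<close> are the squared singular values of \<open>A\<close>. For a contraction they lie in
  the unit interval; their product is \<open>|det A|\<^sup>2\<close> and their sum is the squared Hilbert--Schmidt norm.
  The lower bound thus obtained for \<open>|det A|\<^sup>2\<close> also holds for \<open>|det A|\<close>, which is at most 1.\<close>

lemma contraction_det_hs:
  fixes A :: "complex mat"
  assumes A: "A \<in> carrier_mat d d"
    and contr: "\<And>v. v \<in> carrier_vec d \<Longrightarrow> sqnorm (A *\<^sub>v v) \<le> sqnorm v"
  shows "cmod (Determinant.det A) \<le> 1"
    and "1 - (real d - (hs_norm A)\<^sup>2) \<le> cmod (Determinant.det A)"
    and "(hs_norm A)\<^sup>2 \<le> real d"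
proof -
  define B where "B = mat_adjoint A * A"
  have B: "B \<in> carrier_mat d d" using A by (auto simp: B_def)
  obtain es where es: "length es = d" "\<And>e. e \<in> set es \<Longrightarrow> eigenvalue B e"
    "Determinant.det B = prod_list es" "(\<Sum>i<d. B $$ (i, i)) = sum_list es"
    using trace_det_eigenvalues[OF B] by blast
  define xs where "xs = map Re es"
  have unit: "set es \<subseteq> of_real ` {0..1}"
    using gram_eigenvalue_contraction[OF A contr] es(2) by (auto simp: B_def)
  have "es = map of_real xs"
    unfolding xs_def using unit by (auto simp: comp_def intro!: map_idI[symmetric])
  moreover have xs: "set xs \<subseteq> {0..1}" using unit by (auto simp: xs_def)
  moreover have "prod_list (map complex_of_real ys) = of_real (prod_list ys)"
    "sum_list (map complex_of_real ys) = of_real (sum_list ys)" for ys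
    by (induction ys) auto
  ultimately have d: "Determinant.det B = of_real (prod_list xs)" and t: "(\<Sum>i<d. B $$ (i, i)) = of_real (sum_list xs)"
    using es by auto
  have "of_real ((cmod (Determinant.det A))\<^sup>2) = Determinant.det B"
    using A by (simp add: B_def det_mult[of _ d] det_mat_adjoint[OF A] cmod_square mult.commute)
  then have d2: "(cmod (Determinant.det A))\<^sup>2 = prod_list xs"
    unfolding d of_real_eq_iff .
  have "(hs_norm A)\<^sup>2 = sum_list xs"
  proof -
    have "sum_list xs \<ge> 0" using xs by (intro sum_list_nonneg) auto
    moreover have "hs_norm A = sqrt (Re (\<Sum>i<d. B $$ (i, i)))"
      using B by (auto simp: hs_norm_def B_def Let_def simp del: index_mult_mat)
    ultimately show ?thesis using t by (simp del: Re_sum)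
  qed
  moreover have "length xs = d" by (simp add: xs_def es)
  moreover note prod_list_ge_one_minus_defect[OF xs]
  ultimately have *: "1 - (real d - (hs_norm A)\<^sup>2) \<le> (cmod (Determinant.det A))\<^sup>2"
     "(cmod (Determinant.det A))\<^sup>2 \<le> 1"
    by (auto simp: d2)
  from *(2) show 1: "cmod (Determinant.det A) \<le> 1" by (simp add: abs_square_le_1)
  have "(cmod (Determinant.det A))\<^sup>2 \<le> cmod (Determinant.det A)"
    using 1 by (simp add: power2_eq_square mult_left_le)
  with * show "1 - (real d - (hs_norm A)\<^sup>2) \<le> cmod (Determinant.det A)" by simp
  have "sum_list xs \<le> real (length xs)" using xs by (induction xs) auto
  then show "(hs_norm A)\<^sup>2 \<le> real d" using \<open>(hs_norm A)\<^sup>2 = sum_list xs\<close> \<open>length xs = d\<close> by simp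
qed

section \<open>Averages of unitary matrices\<close>

lemma unitary_col_norm:
  assumes U: "U \<in> carrier (unitary_group d)" and i: "i < d"
  shows "(\<Sum>l<d. (cmod (U $$ (l, i)))\<^sup>2) = 1"
proof -
  have "of_real (\<Sum>l<d. (cmod (U $$ (l, i)))\<^sup>2) = (mat_adjoint U * U) $$ (i, i)"
    using U i by (intro gram_diag[symmetric]) (auto simp: unitary_group_def)
  also have "\<dots> = of_real 1" using U i by (simp add: unitary_group_def)
  finally show ?thesis unfolding of_real_eq_iff .
qed

lemma unitary_entry_le_1:
  assumes U: "U \<in> carrier (unitary_group d)" and ij: "i < d" "j < d"
  shows "cmod (U $$ (i, j)) \<le> 1"
proof -
  have "(cmod (U $$ (i, j)))\<^sup>2 \<le> (\<Sum>l<d. (cmod (U $$ (l, j)))\<^sup>2)"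
    using ij by (intro member_le_sum) auto
  then show ?thesis using unitary_col_norm[OF U ij(2)] by (simp add: abs_square_le_1)
qed

lemma unitary_sqnorm:
  assumes U: "U \<in> carrier (unitary_group d)" and v: "v \<in> carrier_vec d"
  shows "sqnorm (U *\<^sub>v v) = sqnorm v"
proof -
  have "of_real (sqnorm (U *\<^sub>v v)) = (\<Sum>i<d. cnj (v $ i) * v $ i)"
    using U v by (subst sqnorm_mult_vec) (auto simp: unitary_group_def)
  also have "\<dots> = of_real (sqnorm v)"
    using v by (auto simp: sqnorm_def cmod_square mult.commute intro!: sum.cong)
  finally show ?thesis unfolding of_real_eq_iff .
qed

text \<open>Convexity of the square, proved as nonnegativity of the weighted variance of \<open>x\<close>.\<close>

lemma square_average_le:
  fixes w x :: "'b \<Rightarrow> real"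
  assumes "finite S" "\<And>g. g \<in> S \<Longrightarrow> 0 \<le> w g" "sum w S = 1"
  shows "(\<Sum>g\<in>S. w g * x g)\<^sup>2 \<le> (\<Sum>g\<in>S. w g * (x g)\<^sup>2)"
proof -
  define m where "m = (\<Sum>g\<in>S. w g * x g)"
  have "0 \<le> (\<Sum>g\<in>S. w g * (x g - m)\<^sup>2)" using assms by (intro sum_nonneg) auto
  also have "\<dots> = (\<Sum>g\<in>S. w g * (x g)\<^sup>2) - 2 * m * (\<Sum>g\<in>S. w g * x g) + m\<^sup>2 * sum w S"
    by (simp add: power2_diff algebra_simps sum.distrib sum_subtractf sum_distrib_left sum_distrib_right)
  also have "\<dots> = (\<Sum>g\<in>S. w g * (x g)\<^sup>2) - m\<^sup>2"
    using assms by (simp add: m_def power2_eq_square)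
  finally show ?thesis by (simp add: m_def)
qed

definition avg_mat :: "nat \<Rightarrow> ('b \<Rightarrow> real) \<Rightarrow> 'b set \<Rightarrow> ('b \<Rightarrow> complex mat) \<Rightarrow> complex mat" where
  "avg_mat d w S U = mat d d (\<lambda>(i, j). \<Sum>g\<in>S. of_real (w g) * U g $$ (i, j))"

lemma avg_mat_carrier [simp]: "avg_mat d w S U \<in> carrier_mat d d"
  by (simp add: avg_mat_def)

locale averaged_unitaries =
  fixes d :: nat and w :: "'b \<Rightarrow> real" and S :: "'b set" and U :: "'b \<Rightarrow> complex mat"
  assumes finite_S: "finite S"
    and w_nonneg: "g \<in> S \<Longrightarrow> 0 \<le> w g"
    and w_sum: "sum w S = 1"
    and unitary: "g \<in> S \<Longrightarrow> U g \<in> carrier (unitary_group d)"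
begin

lemma U_carrier: "g \<in> S \<Longrightarrow> U g \<in> carrier_mat d d"
  using unitary by (auto simp: unitary_group_def)

text \<open>Unitary matrices preserve lengths, and the squared length of an average is at most the average of
  the squared lengths.\<close>

lemma avg_contraction:
  assumes v: "v \<in> carrier_vec d"
  shows "sqnorm (avg_mat d w S U *\<^sub>v v) \<le> sqnorm v"
proof -
  have "(avg_mat d w S U *\<^sub>v v) $ i = (\<Sum>g\<in>S. of_real (w g) * (U g *\<^sub>v v) $ i)" if "i < d" for i
  proof -
    have "(avg_mat d w S U *\<^sub>v v) $ i = (\<Sum>l<d. (\<Sum>g\<in>S. of_real (w g) * U g $$ (i, l)) * v $ l)"
      using v that by (subst mult_vec_index_sum[of _ d]) (auto simp: avg_mat_def)
    also have "\<dots> = (\<Sum>g\<in>S. \<Sum>l<d. of_real (w g) * U g $$ (i, l) * v $ l)"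
      by (subst sum.swap) (simp add: sum_distrib_right)
    also have "\<dots> = (\<Sum>g\<in>S. of_real (w g) * (U g *\<^sub>v v) $ i)"
      using v that by (intro sum.cong refl)
        (simp add: mult_vec_index_sum[of _ d] U_carrier sum_distrib_left mult_ac del: index_mult_mat_vec)
    finally show ?thesis .
  qed
  then have "cmod ((avg_mat d w S U *\<^sub>v v) $ i) \<le> (\<Sum>g\<in>S. w g * cmod ((U g *\<^sub>v v) $ i))" if "i < d" for i
    using that w_nonneg by (auto simp: norm_mult simp del: index_mult_mat_vec intro!: order_trans[OF norm_sum] sum_mono)
  then have "(cmod ((avg_mat d w S U *\<^sub>v v) $ i))\<^sup>2 \<le> (\<Sum>g\<in>S. w g * (cmod ((U g *\<^sub>v v) $ i))\<^sup>2)" if "i < d" for i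
    using that square_average_le[OF finite_S w_nonneg w_sum, of "\<lambda>g. cmod ((U g *\<^sub>v v) $ i)"]
    by (meson norm_ge_zero order_trans power_mono)
  then have "sqnorm (avg_mat d w S U *\<^sub>v v) \<le> (\<Sum>i<d. \<Sum>g\<in>S. w g * (cmod ((U g *\<^sub>v v) $ i))\<^sup>2)"
    unfolding sqnorm_def by (auto simp: avg_mat_def simp del: index_mult_mat_vec intro!: sum_mono)
  also have "\<dots> = (\<Sum>g\<in>S. w g * (\<Sum>i<d. (cmod ((U g *\<^sub>v v) $ i))\<^sup>2))"
    by (subst sum.swap) (simp add: sum_distrib_left)
  also have "\<dots> = (\<Sum>g\<in>S. w g * sqnorm (U g *\<^sub>v v))"
    using U_carrier by (intro sum.cong refl) (auto simp: sqnorm_def simp del: index_mult_mat_vec(1))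
  also have "\<dots> = sqnorm v"
    using unitary_sqnorm[OF unitary v] w_sum by (simp flip: sum_distrib_right)
  finally show ?thesis .
qed

lemmas avg_det_hs = contraction_det_hs[OF avg_mat_carrier avg_contraction]

text \<open>If nearly all weight sits at \<open>c\<close>, the average is nearly the unitary matrix \<open>U c\<close>: each of its
  entries differs from that of \<open>w c \<cdot> U c\<close> by at most \<open>1 - w c\<close>. What matters about the
  constant is that it depends on the dimension only.\<close>

lemma avg_hs_defect:
  assumes c: "c \<in> S"
  shows "real d - (hs_norm (avg_mat d w S U))\<^sup>2 \<le> (2 * real d + 2 * (real d)\<^sup>2) * (1 - w c)"
proof -
  have rest: "sum w (S - {c}) = 1 - w c" using finite_S c w_sum by (simp add: sum_diff1)
  have wc: "0 \<le> w c" "w c \<le> 1"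
    using w_nonneg[OF c] rest sum_nonneg[of "S - {c}" w] w_nonneg by auto
  have entry: "(w c)\<^sup>2 * (cmod (U c $$ (i, j)))\<^sup>2 - 2 * (1 - w c) \<le> (cmod (avg_mat d w S U $$ (i, j)))\<^sup>2"
    if ij: "i < d" "j < d" for i j
  proof -
    define a where "a = of_real (w c) * U c $$ (i, j)"
    define b where "b = (\<Sum>g\<in>S - {c}. of_real (w g) * U g $$ (i, j))"
    have e: "avg_mat d w S U $$ (i, j) = a + b"
      using ij c finite_S by (simp add: avg_mat_def a_def b_def sum.remove)
    \<comment> \<open>entries of unitary matrices have modulus at most 1\<close>
    have "cmod b \<le> (\<Sum>g\<in>S - {c}. w g * 1)"
      unfolding b_def using w_nonneg ij unitary_entry_le_1[OF unitary]
      by (intro order_trans[OF norm_sum] sum_mono) (auto simp: norm_mult intro!: mult_left_le)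
    then have b: "cmod b \<le> 1 - w c" using rest by simp
    have a: "cmod a = w c * cmod (U c $$ (i, j))" using wc by (simp add: a_def norm_mult)
    then have a1: "cmod a \<le> 1" using wc unitary_entry_le_1[OF unitary[OF c] ij] by (simp add: mult_le_one)
    have t: "cmod a \<le> cmod (a + b) + cmod b" by (metis add_diff_cancel_right' norm_triangle_ineq4)
    have "(cmod a)\<^sup>2 \<le> (cmod (a + b))\<^sup>2 + 2 * cmod b"
    proof (cases "cmod a \<le> cmod b")
      case True
      have "(cmod a)\<^sup>2 \<le> 1 * cmod a" unfolding power2_eq_square using a1 by (intro mult_right_mono) auto
      also have "\<dots> \<le> 2 * cmod b" using True norm_ge_zero[of b] by linarith
      finally show ?thesis using zero_le_power2[of "cmod (a + b)"] by linarith
    next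
      case False
      then have "(cmod a - cmod b)\<^sup>2 \<le> (cmod (a + b))\<^sup>2" using t by (intro power_mono) auto
      moreover have "cmod a * cmod b \<le> 1 * cmod b" using a1 by (intro mult_right_mono) auto
      moreover have "(cmod a - cmod b)\<^sup>2 = (cmod a)\<^sup>2 - 2 * (cmod a * cmod b) + (cmod b)\<^sup>2"
        by (simp add: power2_diff)
      ultimately show ?thesis using zero_le_power2[of "cmod b"] by linarith
    qed
    then show ?thesis using b by (simp add: e a power_mult_distrib)
  qed
  have "(w c)\<^sup>2 * real d - 2 * (1 - w c) * (real d)\<^sup>2 =
     (\<Sum>i<d. \<Sum>j<d. (w c)\<^sup>2 * (cmod (U c $$ (i, j)))\<^sup>2 - 2 * (1 - w c))"
  proof -
    have "(\<Sum>i<d. \<Sum>j<d. (cmod (U c $$ (i, j)))\<^sup>2) = real d"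
      by (subst sum.swap) (simp add: unitary_col_norm[OF unitary[OF c]])
    then show ?thesis by (simp add: sum_subtractf flip: sum_distrib_left) (simp add: power2_eq_square)
  qed
  also have "\<dots> \<le> (hs_norm (avg_mat d w S U))\<^sup>2"
    unfolding hs_norm_square[OF avg_mat_carrier] by (intro sum_mono entry) auto
  finally have "real d - (hs_norm (avg_mat d w S U))\<^sup>2 \<le> real d * (1 - (w c)\<^sup>2) + 2 * (real d)\<^sup>2 * (1 - w c)"
    by (simp add: algebra_simps)
  moreover have "1 - (w c)\<^sup>2 \<le> 2 * (1 - w c)"
    using zero_le_power2[of "1 - w c"] unfolding power2_diff by simp
  then have "real d * (1 - (w c)\<^sup>2) \<le> real d * (2 * (1 - w c))"
    by (rule mult_left_mono) simp
  moreover have "(2 * real d + 2 * (real d)\<^sup>2) * (1 - w c) = real d * (2 * (1 - w c)) + 2 * (real d)\<^sup>2 * (1 - w c)"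
    by (simp add: algebra_simps)
  ultimately show ?thesis by linarith
qed

end

section \<open>Finite-valued functions on finite measure spaces\<close>

text \<open>All groups are finite, so this lemma reduces every integral over a coordinate or a noise variable
  to a finite sum over fibres.\<close>

lemma (in finite_measure) set_integral_finite_valued:
  fixes F :: "'b \<Rightarrow> 'c :: {banach, second_countable_topology}"
  assumes A: "A \<in> sets M" and S: "finite S" and u: "\<And>x. x \<in> space M \<Longrightarrow> u x \<in> S"
    and fib: "\<And>s. s \<in> S \<Longrightarrow> {x \<in> space M. u x = s} \<in> sets M"
  shows "set_integrable M A (\<lambda>x. F (u x))" (is ?int)
    and "(\<integral>x\<in>A. F (u x) \<partial>M) = (\<Sum>s\<in>S. measure M (A \<inter> {x \<in> space M. u x = s}) *\<^sub>R F s)" (is ?eq)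
proof -
  have m: "A \<inter> {x \<in> space M. u x = s} \<in> sets M" if "s \<in> S" for s using A fib[OF that] by auto
  have eq: "indicator A x *\<^sub>R F (u x) = (\<Sum>s\<in>S. indicator (A \<inter> {x \<in> space M. u x = s}) x *\<^sub>R F s)"
    if "x \<in> space M" for x
  proof -
    have "(\<Sum>s\<in>S. indicator (A \<inter> {x \<in> space M. u x = s}) x *\<^sub>R F s) =
       (\<Sum>s\<in>S. if s = u x then indicator A x *\<^sub>R F s else 0)"
      using that by (intro sum.cong refl) (auto simp: indicator_def)
    then show ?thesis using u[OF that] S by simp
  qed
  have i: "integrable M (\<lambda>x. \<Sum>s\<in>S. indicat_real (A \<inter> {x \<in> space M. u x = s}) x *\<^sub>R F s)"
    using m by (intro Bochner_Integration.integrable_sum integrable_scaleR_left integrable_real_indicator)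
      (auto simp: emeasure_eq_measure)
  then show ?int unfolding set_integrable_def
    by (subst Bochner_Integration.integrable_cong[OF refl eq]) auto
  have "(\<integral>x\<in>A. F (u x) \<partial>M) = (\<integral>x. (\<Sum>s\<in>S. indicat_real (A \<inter> {x \<in> space M. u x = s}) x *\<^sub>R F s) \<partial>M)"
    unfolding set_lebesgue_integral_def by (intro Bochner_Integration.integral_cong refl eq)
  also have "\<dots> = (\<Sum>s\<in>S. (\<integral>x. indicat_real (A \<inter> {x \<in> space M. u x = s}) x *\<^sub>R F s \<partial>M))"
    using m by (intro Bochner_Integration.integral_sum integrable_scaleR_left integrable_real_indicator)
      (auto simp: emeasure_eq_measure)
  also have "\<dots> = (\<Sum>s\<in>S. measure M (A \<inter> {x \<in> space M. u x = s}) *\<^sub>R F s)"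
    using m by (intro sum.cong refl, subst integral_scaleR_left)
      (auto simp: Int_absorb1 sets.sets_into_space emeasure_eq_measure intro!: integrable_real_indicator)
  finally show ?eq .
qed

lemma (in finite_measure) integral_finite_valued:
  fixes F :: "'b \<Rightarrow> 'c :: {banach, second_countable_topology}"
  assumes S: "finite S" and u: "\<And>x. x \<in> space M \<Longrightarrow> u x \<in> S"
    and fib: "\<And>s. s \<in> S \<Longrightarrow> {x \<in> space M. u x = s} \<in> sets M"
  shows "(\<integral>x. F (u x) \<partial>M) = (\<Sum>s\<in>S. measure M {x \<in> space M. u x = s} *\<^sub>R F s)"
proof -
  have "(\<integral>x. F (u x) \<partial>M) = (\<integral>x\<in>space M. F (u x) \<partial>M)"
    unfolding set_lebesgue_integral_def by (intro Bochner_Integration.integral_cong) auto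
  also have "\<dots> = (\<Sum>s\<in>S. measure M (space M \<inter> {x \<in> space M. u x = s}) *\<^sub>R F s)"
    by (rule set_integral_finite_valued) (use assms in auto)
  also have "\<dots> = (\<Sum>s\<in>S. measure M {x \<in> space M. u x = s} *\<^sub>R F s)"
    by (intro sum.cong refl arg_cong2[of _ _ _ _ "(*\<^sub>R)"] arg_cong[of _ _ "measure M"]) auto
  finally show ?thesis .
qed

lemma (in finite_measure) measure_eq_sum_fibres:
  assumes A: "A \<in> sets M" and S: "finite S" and u: "\<And>x. x \<in> space M \<Longrightarrow> u x \<in> S"
    and fib: "\<And>s. s \<in> S \<Longrightarrow> {x \<in> space M. u x = s} \<in> sets M"
  shows "measure M A = (\<Sum>s\<in>S. measure M (A \<inter> {x \<in> space M. u x = s}))"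
  using set_integral_finite_valued(2)[OF A S u fib, of "\<lambda>_. 1::real"] sets.sets_into_space[OF A]
  by (simp add: set_lebesgue_integral_def Int_absorb2)

section \<open>Chains of finite groups and their path space\<close>

locale finite_group_chain = compact_group_chain +
  assumes finite_carrier [simp]: "finite (carrier (G k))"
begin

lemma group_G [simp]: "group (G k)"
  using topological_group[of k] by (simp add: topological_group_def)

lemma left_cancel_G:
  "a \<in> carrier (G k) \<Longrightarrow> x \<in> carrier (G k) \<Longrightarrow> y \<in> carrier (G k) \<Longrightarrow>
     a \<otimes>\<^bsub>G k\<^esub> x = a \<otimes>\<^bsub>G k\<^esub> y \<longleftrightarrow> x = y"
  using group.Units_eq[OF group_G[of k]] monoid.Units_l_cancel[OF group.is_monoid[OF group_G[of k]]]
  by simp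

text \<open>A finite Hausdorff space is discrete. Hence all subsets of \<open>G k\<close> are Borel sets and all functions
  on \<open>G k\<close> are continuous.\<close>

lemma T_discrete: "T k = discrete_topology (carrier (G k))"
  using topological_group[of k] Hausdorff[of k]
  by (intro finite_t1_space_imp_discrete_topology Hausdorff_imp_t1_space)
    (auto simp: topological_group_def)

lemma topspace_T [simp]: "topspace (T k) = carrier (G k)"
  by (simp add: T_discrete)

lemma sets_borel_T [simp]: "sets (borel_of (T k)) = Pow (carrier (G k))"
proof -
  have "{U. openin (T k) U} = Pow (carrier (G k))" by (auto simp: T_discrete)
  then show ?thesis
    by (simp add: borel_of_def sets_measure_of sigma_algebra.sigma_sets_eq[OF sigma_algebra_Pow])
qed

lemma space_borel_T [simp]: "space (borel_of (T k)) = carrier (G k)"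
  by (simp add: borel_of_def space_measure_of_conv)

lemma mu_prob: "prob_space (\<mu> k)"
  using noise[of k] by (simp add: borel_prob_on_def)

lemma sets_mu [simp]: "sets (\<mu> k) = Pow (carrier (G k))"
  using noise[of k] by (simp add: borel_prob_on_def)

lemma space_mu [simp]: "space (\<mu> k) = carrier (G k)"
  using sets_eq_imp_space_eq[of "\<mu> k" "borel_of (T k)"] by simp

lemma integral_mu:
  fixes F :: "'a \<Rightarrow> real"
  shows "(\<integral>z. F z \<partial>\<mu> k) = (\<Sum>z\<in>carrier (G k). F z * measure (\<mu> k) {z})"
proof -
  interpret prob_space "\<mu> k" by (rule mu_prob)
  have "(\<integral>z. F z \<partial>\<mu> k) = (\<Sum>z\<in>carrier (G k). measure (\<mu> k) {x \<in> space (\<mu> k). x = z} *\<^sub>R F z)"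
    by (rule integral_finite_valued[of "carrier (G k)" "\<lambda>z. z"]) auto
  also have "\<dots> = (\<Sum>z\<in>carrier (G k). F z * measure (\<mu> k) {z})"
    unfolding real_scaleR_def mult.commute[of "F _"]
    by (intro sum.cong refl arg_cong2[of _ _ _ _ "(*)"] arg_cong[of _ _ "measure (\<mu> k)"]) auto
  finally show ?thesis .
qed

lemma phi_closed [simp, intro]: "x \<in> carrier (G (Suc k)) \<Longrightarrow> \<phi> k x \<in> carrier (G k)"
  using hom[of k] by (auto simp: hom_def)

lemma phi_comp_same [simp]: "phi_comp \<phi> k k = id"
  by (simp add: phi_comp_def)

lemma phi_comp_Suc: "k \<le> l \<Longrightarrow> phi_comp \<phi> k (Suc l) x = phi_comp \<phi> k l (\<phi> l x)"
proof -
  have "foldr (\<circ>) fs f x = foldr (\<circ>) fs id (f x)" for fs :: "('a \<Rightarrow> 'a) list" and f x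
    by (induction fs) auto
  then show "k \<le> l \<Longrightarrow> ?thesis" by (simp add: phi_comp_def)
qed

lemma phi_comp_closed [simp, intro]:
  assumes "k \<le> l" "x \<in> carrier (G l)"
  shows "phi_comp \<phi> k l x \<in> carrier (G k)"
  using assms by (induction l arbitrary: x rule: dec_induct) (auto simp: phi_comp_Suc)

definition \<Omega> :: "(nat \<Rightarrow> 'a) set" where "\<Omega> = (\<Pi>\<^sub>E k\<in>UNIV. carrier (G k))"

lemma Omega_closed [simp, intro]: "x \<in> \<Omega> \<Longrightarrow> x k \<in> carrier (G k)"
  by (auto simp: \<Omega>_def)

text \<open>Folding identifies the carrier of the product group, the point set of the product topology and
  the path space, so that one set of rules serves all three.\<close>

declare \<Omega>_def [symmetric, simp]

lemma space_tail [simp]: "space (tail_sigma T k) = \<Omega>"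
  by (simp add: tail_sigma_def Let_def space_measure_of_conv)

lemma sets_tail: "sets (tail_sigma T k) =
   sigma_sets \<Omega> {(\<lambda>x. x j) -` A \<inter> \<Omega> | j A. j > k \<and> A \<subseteq> carrier (G j)}"
  unfolding tail_sigma_def Let_def by (subst sets_measure_of) auto

lemma coordinate_in_tail:
  assumes "j > k" shows "{x \<in> \<Omega>. Q (x j)} \<in> sets (tail_sigma T k)"
proof -
  have "{x \<in> \<Omega>. Q (x j)} = (\<lambda>x. x j) -` {g \<in> carrier (G j). Q g} \<inter> \<Omega>" by auto
  moreover have "{g \<in> carrier (G j). Q g} \<subseteq> carrier (G j)" by auto
  ultimately show ?thesis using assms unfolding sets_tail by (intro sigma_sets.Basic) blast
qed

lemma coordinates_in_tail:
  assumes "i > k" "j > k" shows "{x \<in> \<Omega>. Q (x i) (x j)} \<in> sets (tail_sigma T k)"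
proof -
  have "{x \<in> \<Omega>. Q (x i) (x j)} = (\<Union>g\<in>carrier (G i). {x \<in> \<Omega>. x i = g} \<inter> {x \<in> \<Omega>. Q g (x j)})" by auto
  also have "\<dots> \<in> sets (tail_sigma T k)"
    using assms by (intro sets.finite_UN sets.Int coordinate_in_tail) auto
  finally show ?thesis .
qed

lemma space_borel_product [simp]: "space (borel_of (product_topology T UNIV)) = \<Omega>"
  by (simp add: borel_of_def space_measure_of_conv)

lemma coordinate_in_borel: "{x \<in> \<Omega>. Q (x j)} \<in> sets (borel_of (product_topology T UNIV))"
proof -
  have "openin (product_topology T UNIV) {x \<in> topspace (product_topology T UNIV). x j \<in> {g \<in> carrier (G j). Q g}}"
    by (intro openin_continuous_map_preimage[OF continuous_map_product_projection]) (auto simp: T_discrete)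
  moreover have "{x \<in> topspace (product_topology T UNIV). x j \<in> {g \<in> carrier (G j). Q g}} = {x \<in> \<Omega>. Q (x j)}"
    by auto
  moreover have "{U. openin (product_topology T UNIV) U} \<subseteq> Pow \<Omega>"
    using openin_subset by fastforce
  ultimately show ?thesis unfolding borel_of_def by (simp add: sets_measure_of)
qed

lemma coordinates_in_borel: "{x \<in> \<Omega>. Q (x i) (x j)} \<in> sets (borel_of (product_topology T UNIV))"
proof -
  have "{x \<in> \<Omega>. Q (x i) (x j)} = (\<Union>g\<in>carrier (G i). {x \<in> \<Omega>. x i = g} \<inter> {x \<in> \<Omega>. Q g (x j)})" by auto
  also have "\<dots> \<in> sets (borel_of (product_topology T UNIV))"
    by (intro sets.finite_UN sets.Int coordinate_in_borel) auto
  finally show ?thesis .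
qed

lemma sets_tail_subset: "sets (tail_sigma T k) \<subseteq> sets (borel_of (product_topology T UNIV))"
  unfolding sets_tail
proof (rule sigma_algebra.sigma_sets_subset)
  show "sigma_algebra \<Omega> (sets (borel_of (product_topology T UNIV)))"
    using sets.sigma_algebra_axioms[of "borel_of (product_topology T UNIV)"] by simp
  have "(\<lambda>x. x j) -` A \<inter> \<Omega> = {x \<in> \<Omega>. x j \<in> A}" for j A by auto
  then show "{(\<lambda>x. x j) -` A \<inter> \<Omega> | j A. j > k \<and> A \<subseteq> carrier (G j)} \<subseteq> sets (borel_of (product_topology T UNIV))"
    using coordinate_in_borel by auto
qed

lemma noise_closed [simp, intro]: "x \<in> \<Omega> \<Longrightarrow> Z G \<phi> k x \<in> carrier (G k)"
  by (simp add: Z_def group.is_monoid monoid.m_closed group.inv_closed)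

text \<open>The noise is the increment that solves the equation at time \<open>k\<close>.\<close>

lemma noise_eq_iff:
  assumes "x \<in> \<Omega>" "z \<in> carrier (G k)"
  shows "Z G \<phi> k x = z \<longleftrightarrow> x k = \<phi> k (x (Suc k)) \<otimes>\<^bsub>G k\<^esub> z"
  using assms group.inv_solve_left'[OF group_G[of k], of z "\<phi> k (x (Suc k))" "x k"]
  unfolding Z_def by auto

lemma noise_in_borel: "{x \<in> \<Omega>. Q (Z G \<phi> j x)} \<in> sets (borel_of (product_topology T UNIV))"
  unfolding Z_def by (rule coordinates_in_borel)

lemma noise_in_tail: "k < j \<Longrightarrow> {x \<in> \<Omega>. Q (Z G \<phi> j x)} \<in> sets (tail_sigma T k)"
  unfolding Z_def by (rule coordinates_in_tail) auto

end

section \<open>Solutions as laws with independent noise\<close>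

context finite_group_chain
begin

text \<open>On finite groups the law of the noise and its independence of the later coordinates are
  determined by the single values \<open>z\<close>.\<close>

definition noise_independent :: "(nat \<Rightarrow> 'a) measure \<Rightarrow> bool" where
  "noise_independent P \<longleftrightarrow> (\<forall>k. \<forall>z\<in>carrier (G k). \<forall>A\<in>sets (tail_sigma T k).
     measure P (A \<inter> {x \<in> \<Omega>. Z G \<phi> k x = z}) = measure (\<mu> k) {z} * measure P A)"

context
  fixes P assumes P: "borel_prob_on (product_topology T UNIV) P"
begin

lemma P_prob: "prob_space P" and sets_P: "sets P = sets (borel_of (product_topology T UNIV))"
  using P by (auto simp: borel_prob_on_def)

lemma space_P: "space P = \<Omega>"
  using sets_eq_imp_space_eq[OF sets_P] by simp

lemma tail_in_P: "A \<in> sets (tail_sigma T k) \<Longrightarrow> A \<in> sets P"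
  using sets_tail_subset sets_P by auto

lemma sigma_finite_subalgebra_tail: "sigma_finite_subalgebra P (tail_sigma T k)"
proof -
  interpret prob_space P by (rule P_prob)
  interpret finite_measure_subalgebra P "tail_sigma T k"
    by unfold_locales (use sets_tail_subset in \<open>auto simp: subalgebra_def space_P sets_P\<close>)
  show ?thesis by unfold_locales
qed

text \<open>The hypothesis is applied to the indicator of a single group element and integrated over the part
  of \<open>A\<close> on which \<open>x (Suc k)\<close> has a fixed value \<open>h\<close>. There the event \<open>Z k = z\<close> says that
  \<open>x k = \<phi> k h z\<close>, and the conditional expectation of its indicator is the constant \<open>\<mu> k {z}\<close>.
  Summation over \<open>h\<close> gives the claim.\<close>

lemma cond_exp_imp_independent:
  assumes ce: "\<And>f :: 'a \<Rightarrow> real. f \<in> borel_measurable (borel_of (T k)) \<Longrightarrow> bounded (f ` carrier (G k)) \<Longrightarrow>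
      AE x in P. real_cond_exp P (tail_sigma T k) (\<lambda>x. f (x k)) x =
                    (\<integral>z. f (\<phi> k (x (Suc k)) \<otimes>\<^bsub>G k\<^esub> z) \<partial>\<mu> k)"
    and z: "z \<in> carrier (G k)" and A: "A \<in> sets (tail_sigma T k)"
  shows "measure P (A \<inter> {x \<in> \<Omega>. Z G \<phi> k x = z}) = measure (\<mu> k) {z} * measure P A"
proof -
  interpret prob_space P by (rule P_prob)
  interpret sigma_finite_subalgebra P "tail_sigma T k" by (rule sigma_finite_subalgebra_tail)
  let ?S = "carrier (G (Suc k))"
  define B where "B h = A \<inter> {x \<in> \<Omega>. x (Suc k) = h}" for h
  have B: "B h \<in> sets (tail_sigma T k)" for h
    unfolding B_def using A by (intro sets.Int coordinate_in_tail) auto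
  have fibre: "measure P (B h \<inter> {x \<in> \<Omega>. Z G \<phi> k x = z}) = measure (\<mu> k) {z} * measure P (B h)" if h: "h \<in> ?S" for h
  proof -
    define g where "g = \<phi> k h \<otimes>\<^bsub>G k\<^esub> z"
    have g: "g \<in> carrier (G k)" using h z by (simp add: g_def group.is_monoid monoid.m_closed)
    define f :: "'a \<Rightarrow> real" where "f = indicator {g}"
    have f: "f \<in> borel_measurable (borel_of (T k))" "bounded (f ` carrier (G k))"
      by (auto simp: f_def intro!: borel_measurable_indicator g finite_imp_bounded)
    have X: "{x \<in> \<Omega>. x k = g} \<in> sets P" using coordinate_in_borel sets_P by simp
    have int: "integrable P (\<lambda>x. f (x k))"
    proof (rule Bochner_Integration.integrable_cong[THEN iffD1, OF refl])
      show "integrable P (indicat_real {x \<in> \<Omega>. x k = g})" using X by (simp add: emeasure_eq_measure)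
    qed (auto simp: f_def space_P indicator_def)
    have "Z G \<phi> k x = z \<longleftrightarrow> x k = g" if "x \<in> \<Omega>" "x (Suc k) = h" for x
      using that by (simp add: g_def noise_eq_iff[OF _ z])
    then have "B h \<inter> {x \<in> \<Omega>. Z G \<phi> k x = z} = B h \<inter> {x \<in> \<Omega>. x k = g}"
      unfolding B_def by blast
    then have "measure P (B h \<inter> {x \<in> \<Omega>. Z G \<phi> k x = z}) = measure P (B h \<inter> {x \<in> \<Omega>. x k = g})"
      by simp
    also have "\<dots> = (\<integral>x\<in>B h. f (x k) \<partial>P)"
    proof -
      have "(\<integral>x\<in>B h. f (x k) \<partial>P) = (\<integral>x. indicator (B h \<inter> {x \<in> \<Omega>. x k = g}) x \<partial>P)"
        unfolding set_lebesgue_integral_def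
        by (intro Bochner_Integration.integral_cong) (auto simp: f_def space_P indicator_def)
      then show ?thesis using tail_in_P[OF B] X
        by (simp add: Int_absorb1 sets.sets_into_space sets.Int)
    qed
    also have "\<dots> = (\<integral>x\<in>B h. real_cond_exp P (tail_sigma T k) (\<lambda>x. f (x k)) x \<partial>P)"
      by (rule real_cond_exp_intA[OF int B])
    also have "\<dots> = (\<integral>x\<in>B h. measure (\<mu> k) {z} \<partial>P)"
      unfolding set_lebesgue_integral_def
    proof (rule integral_cong_AE)
      have "(\<integral>y. f (\<phi> k h \<otimes>\<^bsub>G k\<^esub> y) \<partial>\<mu> k) = measure (\<mu> k) {z}"
      proof -
        have "(\<integral>y. f (\<phi> k h \<otimes>\<^bsub>G k\<^esub> y) \<partial>\<mu> k) = (\<integral>y. indicator {z} y \<partial>\<mu> k)"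
          using h z by (intro Bochner_Integration.integral_cong refl)
            (auto simp: f_def g_def indicator_def left_cancel_G)
        then show ?thesis using z by simp
      qed
      note const = this
      from ce[OF f] show "AE x in P. indicat_real (B h) x *\<^sub>R real_cond_exp P (tail_sigma T k) (\<lambda>x. f (x k)) x =
          indicat_real (B h) x *\<^sub>R measure (\<mu> k) {z}"
        by eventually_elim (auto simp: indicator_def B_def const)
    qed (use tail_in_P[OF B] in auto)
    also have "\<dots> = measure (\<mu> k) {z} * measure P (B h)"
      using tail_in_P[OF B] by (simp add: set_lebesgue_integral_def Int_absorb1 sets.sets_into_space)
    finally show ?thesis .
  qed
  have part: "measure P C = (\<Sum>h\<in>?S. measure P (C \<inter> {x \<in> \<Omega>. x (Suc k) = h}))" if "C \<in> sets P" for C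
    using measure_eq_sum_fibres[OF that, of ?S "\<lambda>x. x (Suc k)"] coordinate_in_borel
    by (simp add: space_P sets_P)
  have "measure P (A \<inter> {x \<in> \<Omega>. Z G \<phi> k x = z}) = (\<Sum>h\<in>?S. measure P (B h \<inter> {x \<in> \<Omega>. Z G \<phi> k x = z}))"
    using tail_in_P[OF A] noise_in_borel[of "\<lambda>y. y = z"]
    by (subst part) (auto simp: sets_P B_def Int_ac)
  also have "\<dots> = measure (\<mu> k) {z} * measure P A"
    using fibre by (simp add: part[OF tail_in_P[OF A]] B_def sum_distrib_left)
  finally show ?thesis .
qed

text \<open>The right-hand side is a function of \<open>x (Suc k)\<close>, hence measurable with respect to the tail. Its
  integral over a tail event is that of \<open>f (x k)\<close>: write \<open>x k = \<phi> k (x (Suc k)) (Z k)\<close>, split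
  according to the values of \<open>x (Suc k)\<close> and \<open>Z k\<close>, and use independence.\<close>

lemma independent_imp_cond_exp:
  fixes f :: "'a \<Rightarrow> real"
  assumes ind: "\<And>z A. z \<in> carrier (G k) \<Longrightarrow> A \<in> sets (tail_sigma T k) \<Longrightarrow>
      measure P (A \<inter> {x \<in> \<Omega>. Z G \<phi> k x = z}) = measure (\<mu> k) {z} * measure P A"
  shows "AE x in P. real_cond_exp P (tail_sigma T k) (\<lambda>x. f (x k)) x =
                    (\<integral>z. f (\<phi> k (x (Suc k)) \<otimes>\<^bsub>G k\<^esub> z) \<partial>\<mu> k)"
proof -
  interpret prob_space P by (rule P_prob)
  interpret sigma_finite_subalgebra P "tail_sigma T k" by (rule sigma_finite_subalgebra_tail)
  let ?S = "carrier (G (Suc k))"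
  define g where "g h = (\<integral>z. f (\<phi> k h \<otimes>\<^bsub>G k\<^esub> z) \<partial>\<mu> k)" for h
  define F where "F = (\<lambda>(h, z). f (\<phi> k h \<otimes>\<^bsub>G k\<^esub> z))"
  have Xk: "f (x k) = F (x (Suc k), Z G \<phi> k x)" if "x \<in> space P" for x
    using noise_eq_iff[of x "Z G \<phi> k x" k] that by (simp add: F_def space_P)
  have fib: "{x \<in> space P. x (Suc k) = s} \<in> sets P" for s
    using coordinate_in_borel by (simp add: space_P sets_P)
  have fib2: "{x \<in> space P. (x (Suc k), Z G \<phi> k x) = s} \<in> sets P" for s
  proof -
    have "{x \<in> space P. (x (Suc k), Z G \<phi> k x) = s} = {x \<in> \<Omega>. x (Suc k) = fst s} \<inter> {x \<in> \<Omega>. Z G \<phi> k x = snd s}"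
      by (auto simp: space_P)
    then show ?thesis using coordinate_in_borel noise_in_borel by (simp add: sets_P sets.Int)
  qed
  have mS: "(\<lambda>x. x (Suc k)) \<in> tail_sigma T k \<rightarrow>\<^sub>M count_space ?S"
  proof (rule measurable_count_space_eq2[THEN iffD2])
    have "(\<lambda>x. x (Suc k)) -` {a} \<inter> \<Omega> = {x \<in> \<Omega>. x (Suc k) = a}" for a by auto
    then show "(\<lambda>x. x (Suc k)) \<in> space (tail_sigma T k) \<rightarrow> ?S \<and>
      (\<forall>a\<in>?S. (\<lambda>x. x (Suc k)) -` {a} \<inter> space (tail_sigma T k) \<in> sets (tail_sigma T k))"
      using coordinate_in_tail[of k "Suc k"] by auto
  qed simp
  have "AE x in P. real_cond_exp P (tail_sigma T k) (\<lambda>x. f (x k)) x = g (x (Suc k))"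
  proof (rule real_cond_exp_charact)
    fix A assume A: "A \<in> sets (tail_sigma T k)"
    have "(\<integral>x\<in>A. f (x k) \<partial>P) = (\<integral>x\<in>A. F (x (Suc k), Z G \<phi> k x) \<partial>P)"
      unfolding set_lebesgue_integral_def by (intro Bochner_Integration.integral_cong refl) (simp add: Xk)
    also have "\<dots> = (\<Sum>s\<in>?S \<times> carrier (G k). measure P (A \<inter> {x \<in> space P. (x (Suc k), Z G \<phi> k x) = s}) *\<^sub>R F s)"
      using A by (intro set_integral_finite_valued tail_in_P fib2) (auto simp: space_P)
    also have "\<dots> = (\<Sum>h\<in>?S. \<Sum>z\<in>carrier (G k). f (\<phi> k h \<otimes>\<^bsub>G k\<^esub> z) *
        measure P ((A \<inter> {x \<in> \<Omega>. x (Suc k) = h}) \<inter> {x \<in> \<Omega>. Z G \<phi> k x = z}))"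
      unfolding sum.cartesian_product F_def real_scaleR_def mult.commute[of "f _"]
      by (intro sum.cong refl) (auto intro!: arg_cong[of _ _ "measure P"] simp: space_P)
    also have "\<dots> = (\<Sum>h\<in>?S. g h * measure P (A \<inter> {x \<in> \<Omega>. x (Suc k) = h}))"
    proof (intro sum.cong refl)
      fix h
      have "A \<inter> {x \<in> \<Omega>. x (Suc k) = h} \<in> sets (tail_sigma T k)"
        using A by (intro sets.Int coordinate_in_tail) auto
      then show "(\<Sum>z\<in>carrier (G k). f (\<phi> k h \<otimes>\<^bsub>G k\<^esub> z) *
        measure P ((A \<inter> {x \<in> \<Omega>. x (Suc k) = h}) \<inter> {x \<in> \<Omega>. Z G \<phi> k x = z})) = g h * measure P (A \<inter> {x \<in> \<Omega>. x (Suc k) = h})"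
        by (simp add: ind g_def integral_mu sum_distrib_left mult_ac)
    qed
    also have "\<dots> = (\<integral>x\<in>A. g (x (Suc k)) \<partial>P)"
      using set_integral_finite_valued(2)[of A ?S "\<lambda>x. x (Suc k)" g] A fib
      by (simp add: tail_in_P space_P mult.commute)
    finally show "(\<integral>x\<in>A. f (x k) \<partial>P) = (\<integral>x\<in>A. g (x (Suc k)) \<partial>P)" .
  next
    have "set_integrable P (space P) (\<lambda>x. F (x (Suc k), Z G \<phi> k x))"
      by (rule set_integral_finite_valued(1)[of _ "?S \<times> carrier (G k)"]) (use fib2 in \<open>auto simp: space_P[symmetric]\<close>)
    then show "integrable P (\<lambda>x. f (x k))"
      unfolding set_integrable_def
      by (rule Bochner_Integration.integrable_cong[THEN iffD1, OF refl, rotated]) (simp add: Xk)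
    have "set_integrable P (space P) (\<lambda>x. g (x (Suc k)))"
      by (rule set_integral_finite_valued(1)[of _ ?S]) (use fib in \<open>auto simp: space_P[symmetric]\<close>)
    then show "integrable P (\<lambda>x. g (x (Suc k)))"
      unfolding set_integrable_def
      by (rule Bochner_Integration.integrable_cong[THEN iffD1, OF refl, rotated]) simp
    show "(\<lambda>x. g (x (Suc k))) \<in> borel_measurable (tail_sigma T k)"
      using measurable_compose[OF mS, of g borel] by simp
  qed
  then show ?thesis by (simp add: g_def)
qed

end

lemma solutions_iff_independent:
  "P \<in> solutions G T \<phi> \<mu> \<longleftrightarrow> borel_prob_on (product_topology T UNIV) P \<and> noise_independent P"
proof
  assume "P \<in> solutions G T \<phi> \<mu>"
  then have P: "borel_prob_on (product_topology T UNIV) P"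
    and ce: "\<And>k. \<And>f :: 'a \<Rightarrow> real. f \<in> borel_measurable (borel_of (T k)) \<Longrightarrow> bounded (f ` carrier (G k)) \<Longrightarrow>
      AE x in P. real_cond_exp P (tail_sigma T k) (\<lambda>x. f (x k)) x =
                    (\<integral>z. f (\<phi> k (x (Suc k)) \<otimes>\<^bsub>G k\<^esub> z) \<partial>\<mu> k)"
    unfolding solutions_def by simp_all
  show "borel_prob_on (product_topology T UNIV) P \<and> noise_independent P"
    unfolding noise_independent_def using P cond_exp_imp_independent[OF P ce] by simp
next
  assume "borel_prob_on (product_topology T UNIV) P \<and> noise_independent P"
  then have P: "borel_prob_on (product_topology T UNIV) P" and ind: "noise_independent P"
    by simp_all
  then show "P \<in> solutions G T \<phi> \<mu>"
    unfolding solutions_def using independent_imp_cond_exp[OF P] by (simp add: noise_independent_def)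
qed

end

section \<open>Freezing as summability\<close>

text \<open>Since \<open>1 - p \<le> exp (- p)\<close>, a lower bound on the products is an upper bound on the partial sums.\<close>

lemma summable_if_prod_bounded_below:
  fixes p :: "nat \<Rightarrow> real"
  assumes p: "\<And>j. 0 \<le> p j" "\<And>j. p j \<le> 1" and \<delta>: "\<delta> > 0" "\<And>n. \<delta> \<le> (\<Prod>j<n. 1 - p j)"
  shows "summable p"
proof (rule summableI_nonneg_bounded)
  fix n
  have "\<delta> \<le> (\<Prod>j<n. 1 - p j)" by (rule \<delta>)
  also have "\<dots> \<le> (\<Prod>j<n. exp (- p j))"
    using p exp_ge_add_one_self[of "- p j" for j] by (intro prod_mono) auto
  also have "\<dots> = exp (- (\<Sum>j<n. p j))" by (simp add: exp_sum sum_negf[symmetric])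
  finally have "ln \<delta> \<le> - (\<Sum>j<n. p j)" using \<delta>(1) by (metis exp_gt_zero ln_exp ln_le_cancel_iff)
  then show "(\<Sum>j<n. p j) \<le> - ln \<delta>" by simp
qed (rule p)

context finite_group_chain
begin

text \<open>The weights of the law of \<open>\<phi>\<^sub>k\<^sup>m (Z m)\<close> on \<open>G k\<close>.\<close>

definition pushed_noise :: "nat \<Rightarrow> nat \<Rightarrow> 'a \<Rightarrow> real" where
  "pushed_noise k m g = measure (\<mu> m) {z \<in> carrier (G m). phi_comp \<phi> k m z = g}"

lemma pushed_noise_nonneg: "0 \<le> pushed_noise k m g" by (simp add: pushed_noise_def)

lemma pushed_noise_le_1: "pushed_noise k m g \<le> 1"
  using prob_space.prob_le_1[OF mu_prob] by (simp add: pushed_noise_def)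

lemma pushed_noise_sum: "k \<le> m \<Longrightarrow> (\<Sum>g\<in>carrier (G k). pushed_noise k m g) = 1"
proof -
  assume "k \<le> m"
  interpret prob_space "\<mu> m" by (rule mu_prob)
  have "(\<integral>z. (1::real) \<partial>\<mu> m) = (\<Sum>g\<in>carrier (G k). measure (\<mu> m) {x \<in> space (\<mu> m). phi_comp \<phi> k m x = g} *\<^sub>R 1)"
    by (rule integral_finite_valued) (use \<open>k \<le> m\<close> in auto)
  then show ?thesis using prob_space by (simp add: pushed_noise_def)
qed

lemma pushed_noise_neq: "measure (\<mu> m) {z \<in> carrier (G m). phi_comp \<phi> k m z \<noteq> g} = 1 - pushed_noise k m g"
proof -
  interpret prob_space "\<mu> m" by (rule mu_prob)
  have "{z \<in> carrier (G m). phi_comp \<phi> k m z \<noteq> g} = space (\<mu> m) - {z \<in> carrier (G m). phi_comp \<phi> k m z = g}"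
    by auto
  moreover have "prob (space (\<mu> m) - {z \<in> carrier (G m). phi_comp \<phi> k m z = g}) =
      1 - prob {z \<in> carrier (G m). phi_comp \<phi> k m z = g}"
    by (rule prob_compl) auto
  ultimately show ?thesis by (simp add: pushed_noise_def)
qed

text \<open>The Borel--Cantelli condition for freezing. It is a property of the laws \<open>\<mu>\<close>, without reference to
  a solution.\<close>

definition noise_concentrates :: bool where
  "noise_concentrates \<longleftrightarrow> (\<exists>c. (\<forall>k m. k \<le> m \<longrightarrow> c k m \<in> carrier (G k)) \<and>
     (\<forall>k. summable (\<lambda>j. 1 - pushed_noise k (k + j) (c k (k + j)))))"

context
  fixes P assumes P: "P \<in> solutions G T \<phi> \<mu>"
begin

lemma P_borel: "borel_prob_on (product_topology T UNIV) P" and P_ind: "noise_independent P"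
  using P by (simp_all add: solutions_iff_independent)

lemma measure_noise_event:
  assumes A: "A \<in> sets (tail_sigma T m)"
  shows "measure P (A \<inter> {x \<in> \<Omega>. Q (Z G \<phi> m x)}) = measure (\<mu> m) {z \<in> carrier (G m). Q z} * measure P A"
proof -
  interpret prob_space P by (rule P_prob[OF P_borel])
  interpret mu: prob_space "\<mu> m" by (rule mu_prob)
  let ?S = "{z \<in> carrier (G m). Q z}"
  have ev: "{x \<in> \<Omega>. R (Z G \<phi> m x)} \<in> sets P" for R using noise_in_borel sets_P[OF P_borel] by simp
  have AP: "A \<in> sets P" using tail_in_P[OF P_borel A] .
  have "measure P (A \<inter> {x \<in> \<Omega>. Q (Z G \<phi> m x)}) = measure P (\<Union>z\<in>?S. A \<inter> {x \<in> \<Omega>. Z G \<phi> m x = z})"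
    by (intro arg_cong[of _ _ "measure P"]) auto
  also have "\<dots> = (\<Sum>z\<in>?S. measure P (A \<inter> {x \<in> \<Omega>. Z G \<phi> m x = z}))"
    using AP ev[of "\<lambda>y. y = z" for z] by (intro finite_measure_finite_Union) (auto simp: disjoint_family_on_def)
  also have "\<dots> = (\<Sum>z\<in>?S. measure (\<mu> m) {z} * measure P A)"
    using P_ind A by (intro sum.cong refl) (auto simp: noise_independent_def)
  also have "\<dots> = measure (\<mu> m) ?S * measure P A"
    using mu.finite_measure_eq_sum_singleton[of ?S] by (simp add: sum_distrib_right)
  finally show ?thesis .
qed

lemma noise_law: "measure P {x \<in> \<Omega>. Q (Z G \<phi> m x)} = measure (\<mu> m) {z \<in> carrier (G m). Q z}"
proof -
  interpret prob_space P by (rule P_prob[OF P_borel])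
  have "\<Omega> \<in> sets (tail_sigma T m)" using sets.top[of "tail_sigma T m"] by simp
  moreover have "\<Omega> \<inter> {x \<in> \<Omega>. Q (Z G \<phi> m x)} = {x \<in> \<Omega>. Q (Z G \<phi> m x)}" by auto
  ultimately show ?thesis
    using measure_noise_event[of \<Omega> m Q] prob_space space_P[OF P_borel] by simp
qed

lemma stay_frozen_in_tail: "i < m \<Longrightarrow> {x \<in> \<Omega>. \<forall>j\<in>{m..<m+n}. Q j (Z G \<phi> j x)} \<in> sets (tail_sigma T i)"
proof -
  assume "i < m"
  then have "(\<Inter>j\<in>insert (m+n) {m..<m+n}. {x \<in> \<Omega>. j < m+n \<longrightarrow> Q j (Z G \<phi> j x)}) \<in> sets (tail_sigma T i)"
    by (intro sets.finite_INT noise_in_tail) auto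
  moreover have "(\<Inter>j\<in>insert (m+n) {m..<m+n}. {x \<in> \<Omega>. j < m+n \<longrightarrow> Q j (Z G \<phi> j x)}) = {x \<in> \<Omega>. \<forall>j\<in>{m..<m+n}. Q j (Z G \<phi> j x)}"
    by auto
  ultimately show ?thesis by simp
qed

text \<open>Peel off the smallest index: the event for the larger indices belongs to the tail beyond \<open>m\<close>, and
  the noise at \<open>m\<close> is independent of it.\<close>

lemma measure_stay_frozen:
  "measure P {x \<in> \<Omega>. \<forall>j\<in>{m..<m+n}. Q j (Z G \<phi> j x)} =
     (\<Prod>j<n. measure (\<mu> (m + j)) {z \<in> carrier (G (m + j)). Q (m + j) z})"
proof (induction n arbitrary: m)
  case 0
  then show ?case using prob_space.prob_space[OF P_prob[OF P_borel]] by (simp add: space_P[OF P_borel])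
next
  case (Suc n)
  have "{x \<in> \<Omega>. \<forall>j\<in>{m..<m + Suc n}. Q j (Z G \<phi> j x)} =
     {x \<in> \<Omega>. \<forall>j\<in>{Suc m..<Suc m+n}. Q j (Z G \<phi> j x)} \<inter> {x \<in> \<Omega>. Q m (Z G \<phi> m x)}"
    by (auto simp: Suc_le_eq le_less)
  then have "measure P {x \<in> \<Omega>. \<forall>j\<in>{m..<m + Suc n}. Q j (Z G \<phi> j x)} = measure (\<mu> m) {z \<in> carrier (G m). Q m z} *
     (\<Prod>j<n. measure (\<mu> (Suc m + j)) {z \<in> carrier (G (Suc m + j)). Q (Suc m + j) z})"
    using measure_noise_event[OF stay_frozen_in_tail[of m "Suc m" n Q], of "Q m"] Suc.IH[of "Suc m"] by simp
  then show ?case by (simp add: prod.lessThan_Suc_shift del: prod.lessThan_Suc)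
qed

text \<open>If the probabilities are summable, the first Borel--Cantelli lemma applies. Conversely, if almost
  surely only finitely many exceptions occur, then from some time \<open>m\<close> on there is none with a
  positive probability \<open>\<delta>\<close>; by independence all partial products of the probabilities of no
  exception are at least \<open>\<delta>\<close>, which forces summability.\<close>

lemma frozen_iff_summable:
  "{x \<in> space P. \<exists>\<^sub>\<infinity>m. k \<le> m \<and> phi_comp \<phi> k m (Z G \<phi> m x) \<noteq> c m} \<in> null_sets P \<longleftrightarrow>
     summable (\<lambda>j. 1 - pushed_noise k (k + j) (c (k + j)))" (is "?N \<in> _ \<longleftrightarrow> ?S")
proof -
  interpret prob_space P by (rule P_prob[OF P_borel])
  note [simp] = space_P[OF P_borel]
  have ev: "{x \<in> \<Omega>. R (Z G \<phi> m x)} \<in> sets P" for R m using noise_in_borel sets_P[OF P_borel] by simp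
  define E where "E m = {x \<in> \<Omega>. k \<le> m \<and> phi_comp \<phi> k m (Z G \<phi> m x) \<noteq> c m}" for m
  have E: "E m \<in> sets P" for m unfolding E_def by (rule ev[of "\<lambda>z. k \<le> m \<and> phi_comp \<phi> k m z \<noteq> c m"])
  have ME: "measure P (E (k + j)) = 1 - pushed_noise k (k + j) (c (k + j))" for j
    using noise_law[of "\<lambda>z. phi_comp \<phi> k (k+j) z \<noteq> c (k+j)" "k + j"] by (simp add: E_def pushed_noise_neq)
  have NE: "?N = limsup E"
    by (auto simp: E_def limsup_INF_SUP INFM_nat_le)
  show ?thesis
  proof
    assume ?S
    then have "summable (\<lambda>j. measure P (E (j + k)))" using ME by (simp add: add.commute)
    then have "summable (\<lambda>m. measure P (E m))" by (simp add: summable_iff_shift[of "\<lambda>m. measure P (E m)"])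
    then show "?N \<in> null_sets P" unfolding NE
      using E by (intro borel_cantelli_limsup1) (auto simp: emeasure_eq_measure)
  next
    assume N: "?N \<in> null_sets P"
    let ?Q = "\<lambda>j z. phi_comp \<phi> k j z = c j"
    \<comment> \<open>no exception from time \<open>m\<close> on\<close>
    define F where "F m = {x \<in> \<Omega>. \<forall>j\<ge>m. ?Q j (Z G \<phi> j x)}" for m
    have F: "F m \<in> sets P" for m
    proof -
      have "F m = (\<Inter>j\<in>{m..}. {x \<in> \<Omega>. ?Q j (Z G \<phi> j x)})" by (auto simp: F_def)
      also have "\<dots> \<in> sets P" by (intro sets.countable_INT') (auto intro: ev)
      finally show ?thesis .
    qed
    have "\<exists>m\<ge>k. measure P (F m) > 0"
    proof (rule ccontr)
      assume "\<not> ?thesis"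
      then have "measure P (F (k + j)) \<le> 0" for j by (auto simp: not_less)
      then have "F (k + j) \<in> null_sets P" for j
        using F by (simp add: null_sets_def emeasure_eq_measure order_antisym)
      then have "(\<Union>j. F (k + j)) \<union> ?N \<in> null_sets P" using N by auto
      moreover have "(\<Union>j. F (k + j)) \<union> ?N = \<Omega>"
      proof -
        have "x \<in> (\<Union>j. F (k + j))" if "x \<in> \<Omega>" "x \<notin> ?N" for x
        proof -
          have "\<forall>\<^sub>\<infinity>n. k \<le> n \<longrightarrow> ?Q n (Z G \<phi> n x)" using that by simp
          then obtain m where m: "\<forall>n\<ge>m. k \<le> n \<longrightarrow> ?Q n (Z G \<phi> n x)"
            unfolding MOST_nat_le by blast
          then have "x \<in> F (k + m)" using that by (auto simp: F_def)
          then show ?thesis by auto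
        qed
        moreover have "(\<Union>j. F (k + j)) \<union> ?N \<subseteq> \<Omega>" by (auto simp: F_def)
        ultimately show ?thesis by blast
      qed
      ultimately show False using prob_space by (simp add: null_sets_def emeasure_eq_measure)
    qed
    then obtain m where m: "m \<ge> k" "measure P (F m) > 0" by blast
    have "summable (\<lambda>j. 1 - pushed_noise k (m + j) (c (m + j)))"
    proof (rule summable_if_prod_bounded_below[OF _ _ m(2)])
      fix n
      have "measure P (F m) \<le> measure P {x \<in> \<Omega>. \<forall>j\<in>{m..<m+n}. ?Q j (Z G \<phi> j x)}"
      proof (rule finite_measure_mono)
        show "{x \<in> \<Omega>. \<forall>j\<in>{m..<m+n}. ?Q j (Z G \<phi> j x)} \<in> sets P"
          using sets.sets_Collect_finite_All[of "{m..<m+n}" P "\<lambda>j x. ?Q j (Z G \<phi> j x)"] ev by simp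
      qed (auto simp: F_def)
      also have "\<dots> = (\<Prod>j<n. 1 - (1 - pushed_noise k (m + j) (c (m + j))))"
        by (simp add: measure_stay_frozen[of m n ?Q] pushed_noise_def)
      finally show "measure P (F m) \<le> (\<Prod>j<n. 1 - (1 - pushed_noise k (m + j) (c (m + j))))" .
    qed (auto simp: pushed_noise_nonneg pushed_noise_le_1)
    moreover obtain i where i: "m = k + i" using m(1) le_Suc_ex by blast
    ultimately show ?S
      using summable_iff_shift[of "\<lambda>j. 1 - pushed_noise k (k + j) (c (k + j))" i] by (simp add: add_ac)
  qed
qed

lemma eventually_frozen_iff: "eventually_frozen G \<phi> P \<longleftrightarrow> noise_concentrates"
  unfolding eventually_frozen_def noise_concentrates_def by (simp add: frozen_iff_summable)

end

end

section \<open>Determinants and norms of averaged representations\<close>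

text \<open>The products decrease in \<open>n\<close>, so their limits \<open>L m\<close> exist, and Weierstrass' product inequality
  bounds \<open>L m\<close> from below by one minus the tail of the series.\<close>

lemma tail_products_tendsto_1:
  fixes b :: "nat \<Rightarrow> real"
  assumes b: "\<And>j. b j \<in> {0..1}" and sm: "summable (\<lambda>j. 1 - b j)"
  shows "\<exists>L. (\<forall>m. (\<lambda>n. \<Prod>j\<in>{m..<Suc n}. b j) \<longlonglongrightarrow> L m) \<and> L \<longlonglongrightarrow> 1"
proof -
  define p where "p m n = (\<Prod>j\<in>{m..<Suc n}. b j)" for m n
  have p01: "0 \<le> p m n" "p m n \<le> 1" for m n
    using b unfolding p_def by (auto simp del: prod.op_ivl_Suc intro!: prod_nonneg prod_le_1)
  have "decseq (p m)" for m
  proof (rule decseq_SucI)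
    fix n show "p m (Suc n) \<le> p m n"
    proof (cases "m \<le> Suc n")
      case True
      then have "p m (Suc n) = p m n * b (Suc n)" by (simp add: p_def)
      also have "\<dots> \<le> p m n" using b[of "Suc n"] p01[of m n] by (intro mult_right_le_one_le) auto
      finally show ?thesis .
    qed (simp add: p_def)
  qed
  then have "\<exists>l. p m \<longlonglongrightarrow> l" for m
    by (rule decseq_convergent[of _ 0]) (use p01(1) in auto)
  then obtain L where L: "\<And>m. p m \<longlonglongrightarrow> L m" by metis
  have upper: "L m \<le> 1" for m using p01(2) by (intro LIMSEQ_le_const2[OF L]) auto
  have lower: "1 - (\<Sum>i. 1 - b (i + m)) \<le> L m" for m
  proof (rule LIMSEQ_le_const[OF L])
    have "1 - (\<Sum>i. 1 - b (i + m)) \<le> p m n" for n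
    proof -
      have "(\<Sum>j\<in>{m..<Suc n}. 1 - b j) = (\<Sum>i<Suc n - m. 1 - b (i + m))"
        by (rule sum.reindex_bij_witness[of _ "\<lambda>i. i + m" "\<lambda>j. j - m"]) auto
      also have "\<dots> \<le> (\<Sum>i. 1 - b (i + m))"
        using b summable_ignore_initial_segment[OF sm] by (intro sum_le_suminf) auto
      finally have "1 - (\<Sum>i. 1 - b (i + m)) \<le> 1 - (\<Sum>j\<in>{m..<Suc n}. 1 - b j)" by simp
      also have "\<dots> \<le> p m n"
        using Weierstrass_prod_ineq[of "{m..<Suc n}" "\<lambda>j. 1 - b j"] b unfolding p_def by auto
      finally show ?thesis .
    qed
    then show "\<exists>N. \<forall>n\<ge>N. 1 - (\<Sum>i. 1 - b (i + m)) \<le> p m n" by blast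
  qed
  have "(\<lambda>m. 1 - (\<Sum>i. 1 - b (i + m))) \<longlonglongrightarrow> 1 - 0"
    by (intro tendsto_diff tendsto_const suminf_exist_split2 sm)
  then have "(\<lambda>m. 1 - (\<Sum>i. 1 - b (i + m))) \<longlonglongrightarrow> 1" by simp
  then have "L \<longlonglongrightarrow> 1"
    using lower upper by (intro tendsto_sandwich[OF _ _ _ tendsto_const, of _ L]) (auto intro: always_eventually)
  then show ?thesis using L unfolding p_def by (intro exI[of _ L]) simp
qed

text \<open>The case \<open>m = Suc n\<close> of an empty product serves as the start of the induction.\<close>

lemma det_R_prod:
  "m \<le> Suc n \<Longrightarrow> Determinant.det (R_prod G \<phi> \<mu> \<rho> k m n) = (\<Prod>j\<in>{m..<Suc n}. Determinant.det (R G \<phi> \<mu> \<rho> k j))"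
proof (induction n)
  case 0
  have "R G \<phi> \<mu> \<rho> k 0 \<in> carrier_mat (rep_dim G \<rho>) (rep_dim G \<rho>)" by (simp add: R_def)
  with 0 show ?case by (cases m) (auto simp: R_prod_def)
next
  case (Suc n)
  let ?d = "rep_dim G \<rho>"
  have R: "R G \<phi> \<mu> \<rho> k j \<in> carrier_mat ?d ?d" for j by (simp add: R_def)
  have fold: "foldr (*) (map (R G \<phi> \<mu> \<rho> k) js) (1\<^sub>m ?d) \<in> carrier_mat ?d ?d" for js
    by (induction js) (auto intro!: mult_carrier_mat[OF R])
  show ?case
  proof (cases "m = Suc (Suc n)")
    case True
    then show ?thesis by (simp add: R_prod_def)
  next
    case False
    then have m: "m \<le> Suc n" using Suc.prems by simp
    then have "R_prod G \<phi> \<mu> \<rho> k m (Suc n) = R G \<phi> \<mu> \<rho> k (Suc n) * R_prod G \<phi> \<mu> \<rho> k m n"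
      by (simp add: R_prod_def)
    then have "Determinant.det (R_prod G \<phi> \<mu> \<rho> k m (Suc n)) =
        Determinant.det (R G \<phi> \<mu> \<rho> k (Suc n)) * Determinant.det (R_prod G \<phi> \<mu> \<rho> k m n)"
      using det_mult[OF R fold] by (simp add: R_prod_def)
    then show ?thesis using Suc.IH[OF m] m by (simp add: mult.commute)
  qed
qed

context finite_group_chain
begin

lemma iota_closed [simp]: "g \<in> carrier (G k) \<Longrightarrow> \<iota> G k g \<in> \<Omega>"
  unfolding \<Omega>_def \<iota>_def by (auto simp: group.is_monoid monoid.one_closed simp del: \<Omega>_def[symmetric])

lemma one_in_Omega: "\<one>\<^bsub>product_group UNIV G\<^esub> \<in> \<Omega>"
  unfolding \<Omega>_def by (auto simp: group.is_monoid monoid.one_closed simp del: \<Omega>_def[symmetric])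

lemma rep_unitary:
  assumes "\<rho> \<in> reps G T" "x \<in> \<Omega>"
  shows "\<rho> x \<in> carrier (unitary_group (rep_dim G \<rho>))"
proof -
  obtain d where "\<rho> \<in> hom (product_group UNIV G) (unitary_group d)"
    using assms(1) by (auto simp: reps_def)
  then have U: "\<rho> y \<in> carrier (unitary_group d)" if "y \<in> \<Omega>" for y
    using that by (auto simp: hom_def Pi_iff)
  then have "rep_dim G \<rho> = d" using U[OF one_in_Omega] unfolding rep_dim_def by (auto simp: unitary_group_def)
  then show ?thesis using U assms(2) by simp
qed

text \<open>The integrand depends on \<open>z\<close> only through \<open>\<phi>\<^sub>k\<^sup>l z\<close>.\<close>

lemma R_eq_average:
  assumes kl: "k \<le> l"
  shows "R G \<phi> \<mu> \<rho> k l = avg_mat (rep_dim G \<rho>) (pushed_noise k l) (carrier (G k)) (\<lambda>g. \<rho> (\<iota> G k g))"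
proof -
  interpret prob_space "\<mu> l" by (rule mu_prob)
  have "(\<integral>z. \<rho> (\<iota> G k (phi_comp \<phi> k l z)) $$ (i, j) \<partial>\<mu> l) =
     (\<Sum>g\<in>carrier (G k). of_real (pushed_noise k l g) * \<rho> (\<iota> G k g) $$ (i, j))" for i j
    using integral_finite_valued[of "carrier (G k)" "phi_comp \<phi> k l" "\<lambda>g. \<rho> (\<iota> G k g) $$ (i, j)"] kl
    by (auto simp: pushed_noise_def scaleR_conv_of_real)
  then show ?thesis by (auto simp: R_def avg_mat_def)
qed

lemma averaged_unitaries_rep:
  assumes "\<rho> \<in> reps G T" "k \<le> l"
  shows "averaged_unitaries (rep_dim G \<rho>) (pushed_noise k l) (carrier (G k)) (\<lambda>g. \<rho> (\<iota> G k g))"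
  using assms by unfold_locales (auto simp: pushed_noise_nonneg pushed_noise_sum rep_unitary)

lemma R_det_hs:
  assumes "\<rho> \<in> reps G T" "k \<le> l"
  shows "cmod (Determinant.det (R G \<phi> \<mu> \<rho> k l)) \<le> 1"
    and "1 - (real (rep_dim G \<rho>) - (hs_norm (R G \<phi> \<mu> \<rho> k l))\<^sup>2) \<le> cmod (Determinant.det (R G \<phi> \<mu> \<rho> k l))"
    and "(hs_norm (R G \<phi> \<mu> \<rho> k l))\<^sup>2 \<le> real (rep_dim G \<rho>)"
  using averaged_unitaries.avg_det_hs[OF averaged_unitaries_rep[OF assms]] by (simp_all only: R_eq_average[OF assms(2)])

text \<open>The defect \<open>1 - |det (R k m)|\<close> is dominated by the corresponding term of the freezing series.\<close>

lemma H_freeze_subset_H_det: "H_freeze G T \<phi> \<mu> \<subseteq> H_det G T \<phi> \<mu>"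
proof
  fix \<rho> assume "\<rho> \<in> H_freeze G T \<phi> \<mu>"
  then have \<rho>: "\<rho> \<in> reps G T"
    and sm: "\<And>k. summable (\<lambda>j. real (rep_dim G \<rho>) - (hs_norm (R G \<phi> \<mu> \<rho> k (k + j)))\<^sup>2)"
    by (auto simp: H_freeze_def)
  have "\<exists>L l. (\<forall>m\<ge>k. (\<lambda>n. cmod (Determinant.det (R_prod G \<phi> \<mu> \<rho> k m n))) \<longlonglongrightarrow> L m) \<and> L \<longlonglongrightarrow> l \<and> l > (0 :: real)" for k
  proof -
    \<comment> \<open>\<open>R k j\<close> has no meaning for \<open>j < k\<close>; these factors do not enter the limits\<close>
    define b where "b j = (if j < k then 1 else cmod (Determinant.det (R G \<phi> \<mu> \<rho> k j)))" for j
    have "b j \<in> {0..1}" for j using R_det_hs(1)[OF \<rho>, of k j] by (auto simp: b_def)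
    moreover have "summable (\<lambda>j. 1 - b (j + k))"
    proof (rule summable_comparison_test'[OF sm[of k], of 0])
      fix j show "norm (1 - b (j + k)) \<le> real (rep_dim G \<rho>) - (hs_norm (R G \<phi> \<mu> \<rho> k (k + j)))\<^sup>2"
        using R_det_hs(1,2)[OF \<rho>, of k "k + j"] by (auto simp: b_def add.commute)
    qed
    then have "summable (\<lambda>j. 1 - b j)" by (simp only: summable_iff_shift[of "\<lambda>j. 1 - b j"])
    ultimately obtain L where L: "\<And>m. (\<lambda>n. \<Prod>j\<in>{m..<Suc n}. b j) \<longlonglongrightarrow> L m" "L \<longlonglongrightarrow> 1"
      using tail_products_tendsto_1[of b] by blast
    have "(\<lambda>n. cmod (Determinant.det (R_prod G \<phi> \<mu> \<rho> k m n))) \<longlonglongrightarrow> L m" if "m \<ge> k" for m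
    proof (rule Lim_transform_eventually[OF L(1)])
      show "\<forall>\<^sub>F n in sequentially. (\<Prod>j\<in>{m..<Suc n}. b j) = cmod (Determinant.det (R_prod G \<phi> \<mu> \<rho> k m n))"
        using eventually_ge_at_top[of m]
      proof eventually_elim
        case (elim n)
        then show ?case using that by (auto simp: det_R_prod prod_norm[symmetric] b_def simp del: prod.op_ivl_Suc intro!: prod.cong)
      qed
    qed
    then show ?thesis using L(2) by (intro exI[of _ L] exI[of _ 1]) auto
  qed
  then show "\<rho> \<in> H_det G T \<phi> \<mu>" using \<rho> by (simp add: H_det_def)
qed

lemma concentrates_imp_freeze:
  assumes "noise_concentrates"
  shows "H_freeze G T \<phi> \<mu> = reps G T"
proof -
  obtain c where c: "\<And>k m. k \<le> m \<Longrightarrow> c k m \<in> carrier (G k)"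
    and sm: "\<And>k. summable (\<lambda>j. 1 - pushed_noise k (k + j) (c k (k + j)))"
    using assms unfolding noise_concentrates_def by blast
  have "summable (\<lambda>j. real (rep_dim G \<rho>) - (hs_norm (R G \<phi> \<mu> \<rho> k (k + j)))\<^sup>2)" if \<rho>: "\<rho> \<in> reps G T" for \<rho> k
  proof (rule summable_comparison_test'[of _ 0])
    let ?C = "2 * real (rep_dim G \<rho>) + 2 * (real (rep_dim G \<rho>))\<^sup>2"
    show "summable (\<lambda>j. ?C * (1 - pushed_noise k (k + j) (c k (k + j))))" by (intro summable_mult sm)
    fix j
    show "norm (real (rep_dim G \<rho>) - (hs_norm (R G \<phi> \<mu> \<rho> k (k + j)))\<^sup>2) \<le> ?C * (1 - pushed_noise k (k + j) (c k (k + j)))"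
      using averaged_unitaries.avg_hs_defect[OF averaged_unitaries_rep[OF \<rho>, of k "k + j"] c] R_det_hs(3)[OF \<rho>, of k "k + j"]
      by (simp add: R_eq_average)
  qed
  then show ?thesis by (auto simp: H_freeze_def)
qed

end

section \<open>The regular representation detects concentration\<close>

context finite_group_chain
begin

text \<open>Left translation on \<open>G k\<close>, written as permutation matrices in an enumeration \<open>e\<close> of the group and
  pulled back along the coordinate \<open>k\<close>.\<close>

lemma regular_rep:
  obtains e \<rho> where "bij_betw e {..<card (carrier (G k))} (carrier (G k))" "\<rho> \<in> reps G T"
    "rep_dim G \<rho> = card (carrier (G k))"
    "\<And>x. x \<in> \<Omega> \<Longrightarrow> \<rho> x = mat (card (carrier (G k))) (card (carrier (G k))) (\<lambda>(i, j). if e i = x k \<otimes>\<^bsub>G k\<^esub> e j then 1 else 0)"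
proof -
  interpret Gk: group "G k" by simp
  define N where "N = card (carrier (G k))"
  obtain e where e: "bij_betw e {..<N} (carrier (G k))"
    using ex_bij_betw_nat_finite[OF finite_carrier] by (auto simp: N_def atLeast0LessThan)
  have ec [simp]: "e i \<in> carrier (G k)" if "i < N" for i using e that by (auto simp: bij_betw_def)
  have ei: "e i = e j \<longleftrightarrow> i = j" if "i < N" "j < N" for i j
    using e that by (auto simp: bij_betw_def inj_on_def)
  have count: "(\<Sum>l<N. if e l = h then f (e l) else 0) = f h" if "h \<in> carrier (G k)" for h and f :: "'a \<Rightarrow> complex"
    using sum.reindex_bij_betw[OF e, of "\<lambda>l. if l = h then f l else 0"] that by simp
  define M where "M g = mat N N (\<lambda>(i, j). if e i = g \<otimes>\<^bsub>G k\<^esub> e j then 1 else 0 :: complex)" for g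
  have M: "M g \<in> carrier_mat N N" for g by (simp add: M_def)
  have mult: "M (g \<otimes>\<^bsub>G k\<^esub> h) = M g * M h" if gh: "g \<in> carrier (G k)" "h \<in> carrier (G k)" for g h
  proof (rule eq_matI)
    fix i j assume "i < dim_row (M g * M h)" "j < dim_col (M g * M h)"
    then have ij: "i < N" "j < N" by (simp_all add: M_def)
    have "(M g * M h) $$ (i, j) = (\<Sum>l<N. if e l = h \<otimes>\<^bsub>G k\<^esub> e j then (if e i = g \<otimes>\<^bsub>G k\<^esub> e l then 1 else 0) else 0)"
      unfolding mult_index_sum[OF M M ij] using ij by (intro sum.cong refl) (auto simp: M_def)
    also have "\<dots> = (if e i = g \<otimes>\<^bsub>G k\<^esub> (h \<otimes>\<^bsub>G k\<^esub> e j) then 1 else 0)"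
      using gh ij by (intro count) auto
    finally show "M (g \<otimes>\<^bsub>G k\<^esub> h) $$ (i, j) = (M g * M h) $$ (i, j)"
      using gh ij by (simp add: M_def Gk.m_assoc)
  qed (auto simp: M_def)
  have one: "M \<one>\<^bsub>G k\<^esub> = 1\<^sub>m N"
    by (rule eq_matI) (auto simp: M_def ei)
  have adj: "mat_adjoint (M g) = M (inv\<^bsub>G k\<^esub> g)" if "g \<in> carrier (G k)" for g
  proof (rule eq_matI)
    fix i j assume "i < dim_row (M (inv\<^bsub>G k\<^esub> g))" "j < dim_col (M (inv\<^bsub>G k\<^esub> g))"
    then have ij: "i < N" "j < N" by (auto simp: M_def)
    have "e j = g \<otimes>\<^bsub>G k\<^esub> e i \<longleftrightarrow> e i = inv\<^bsub>G k\<^esub> g \<otimes>\<^bsub>G k\<^esub> e j"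
      using ij that Gk.inv_solve_left[of "e i" g "e j"] by simp
    then show "mat_adjoint (M g) $$ (i, j) = M (inv\<^bsub>G k\<^esub> g) $$ (i, j)"
      unfolding mat_adjoint_index[OF M ij] using ij by (simp add: M_def)
  qed (auto simp: M_def)
  have unitary: "M g \<in> carrier (unitary_group N)" if "g \<in> carrier (G k)" for g
    using that M by (simp add: unitary_group_def adj mult[symmetric] one)
  define \<rho> where "\<rho> = restrict (\<lambda>x. M (x k)) \<Omega>"
  have \<rho>: "\<rho> x = M (x k)" if "x \<in> \<Omega>" for x using that by (simp add: \<rho>_def)
  have closed: "(\<lambda>i. x i \<otimes>\<^bsub>G i\<^esub> y i) \<in> \<Omega>" if "x \<in> \<Omega>" "y \<in> \<Omega>" for x y
    using Omega_closed[OF that(1)] Omega_closed[OF that(2)] unfolding \<Omega>_def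
    by (auto simp: group.is_monoid monoid.m_closed simp del: \<Omega>_def[symmetric])
  have "\<rho> \<in> hom (product_group UNIV G) (unitary_group N)"
  proof (rule homI)
    have [simp]: "monoid.mult (unitary_group N) = (*)" by (simp add: unitary_group_def)
    show "\<rho> (x \<otimes>\<^bsub>product_group UNIV G\<^esub> y) = \<rho> x \<otimes>\<^bsub>unitary_group N\<^esub> \<rho> y"
      if "x \<in> carrier (product_group UNIV G)" "y \<in> carrier (product_group UNIV G)" for x y
      using that closed[of x y] by (simp add: \<rho> mult restrict_def)
  qed (simp add: \<rho> unitary)
  moreover have "continuous_map (product_topology T UNIV) euclidean (\<lambda>x. \<rho> x $$ (i, j))" for i j
  proof (rule continuous_map_eq)
    show "continuous_map (product_topology T UNIV) euclidean ((\<lambda>g. M g $$ (i, j)) \<circ> (\<lambda>x. x k))"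
      by (intro continuous_map_compose[OF continuous_map_product_projection]) (auto simp: T_discrete)
  qed (auto simp: \<rho>)
  moreover have "\<rho> \<in> extensional (carrier (product_group UNIV G))" by (simp add: \<rho>_def)
  ultimately have "\<rho> \<in> reps G T" unfolding reps_def by blast
  moreover have "rep_dim G \<rho> = N" unfolding rep_dim_def \<rho>[OF one_in_Omega] by (simp add: M_def)
  ultimately show thesis using that[of e \<rho>] e \<rho> by (simp add: M_def N_def)
qed

text \<open>For the regular representation of \<open>G k\<close>, of dimension \<open>N\<close>, the entry of \<open>R k m\<close> at \<open>(a, b)\<close> is the
  weight of \<open>e a (e b)\<^sup>-\<^sup>1\<close>. Every weight occurs \<open>N\<close> times, so \<open>\<parallel>R k m\<parallel>\<^sup>2 = N (\<Sum>\<^sub>g w(g)\<^sup>2)\<close>. If \<open>c\<close> is a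
  most likely point, then \<open>\<Sum>\<^sub>g w(g)\<^sup>2 \<le> w(c)\<close>, whence \<open>1 - w(c) \<le> N - \<parallel>R k m\<parallel>\<^sup>2\<close>.\<close>

lemma freeze_imp_concentrates:
  assumes "H_freeze G T \<phi> \<mu> = reps G T"
  shows "noise_concentrates"
proof -
  define c where "c k m = (SOME g. g \<in> carrier (G k) \<and> (\<forall>h\<in>carrier (G k). pushed_noise k m h \<le> pushed_noise k m g))" for k m
  have ex: "\<exists>g. g \<in> carrier (G k) \<and> (\<forall>h\<in>carrier (G k). pushed_noise k m h \<le> pushed_noise k m g)" for k m
  proof -
    have ne: "carrier (G k) \<noteq> {}" using monoid.one_closed[OF group.is_monoid[OF group_G[of k]]] by auto
    have "Max (pushed_noise k m ` carrier (G k)) \<in> pushed_noise k m ` carrier (G k)" using ne by (intro Max_in) auto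
    then obtain g where "g \<in> carrier (G k)" "Max (pushed_noise k m ` carrier (G k)) = pushed_noise k m g" by auto
    moreover have "pushed_noise k m h \<le> Max (pushed_noise k m ` carrier (G k))" if "h \<in> carrier (G k)" for h
      using that by (intro Max_ge) auto
    ultimately show ?thesis by auto
  qed
  have "c k m \<in> carrier (G k) \<and> (\<forall>h\<in>carrier (G k). pushed_noise k m h \<le> pushed_noise k m (c k m))" for k m
    unfolding c_def by (rule someI_ex) (rule ex)
  then have c: "c k m \<in> carrier (G k)" "h \<in> carrier (G k) \<Longrightarrow> pushed_noise k m h \<le> pushed_noise k m (c k m)" for k m h
    by blast+
  have "summable (\<lambda>j. 1 - pushed_noise k (k + j) (c k (k + j)))" for k
  proof -
    interpret Gk: group "G k" by simp
    define N where "N = card (carrier (G k))"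
    obtain e \<rho> where e: "bij_betw e {..<N} (carrier (G k))" and \<rho>: "\<rho> \<in> reps G T" "rep_dim G \<rho> = N"
      "\<And>x. x \<in> \<Omega> \<Longrightarrow> \<rho> x = mat N N (\<lambda>(i, j). if e i = x k \<otimes>\<^bsub>G k\<^esub> e j then 1 else 0)"
      by (rule regular_rep[of k, folded N_def]) (rule that)
    have ec [simp]: "e i \<in> carrier (G k)" if "i < N" for i using e that by (auto simp: bij_betw_def)
    have \<rho>_iota: "\<rho> (\<iota> G k g) = mat N N (\<lambda>(i, j). if e i = g \<otimes>\<^bsub>G k\<^esub> e j then 1 else 0)"
      if "g \<in> carrier (G k)" for g
      using \<rho>(3)[OF iota_closed[OF that]] by (simp add: \<iota>_def)
    have N: "N \<ge> 1" unfolding N_def using Gk.one_closed card_gt_0_iff[of "carrier (G k)"] by (auto simp: Suc_le_eq)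
    show ?thesis
    proof (rule summable_comparison_test'[of _ 0])
      show "summable (\<lambda>j. real (rep_dim G \<rho>) - (hs_norm (R G \<phi> \<mu> \<rho> k (k + j)))\<^sup>2)"
        using assms \<rho>(1) by (auto simp: H_freeze_def)
      fix j
      define w where "w = pushed_noise k (k + j)"
      have entry: "R G \<phi> \<mu> \<rho> k (k + j) $$ (a, b) = of_real (w (e a \<otimes>\<^bsub>G k\<^esub> inv\<^bsub>G k\<^esub> e b))"
        if ab: "a < N" "b < N" for a b
      proof -
        have "R G \<phi> \<mu> \<rho> k (k + j) $$ (a, b) =
           (\<Sum>g\<in>carrier (G k). if g = e a \<otimes>\<^bsub>G k\<^esub> inv\<^bsub>G k\<^esub> e b then of_real (w g) else 0)"
          using ab Gk.inv_solve_right[of _ "e a" "e b"]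
          by (auto simp: R_eq_average avg_mat_def \<rho>(2) \<rho>_iota w_def intro!: sum.cong)
        then show ?thesis using ab by simp
      qed
      have "(hs_norm (R G \<phi> \<mu> \<rho> k (k + j)))\<^sup>2 = (\<Sum>b<N. \<Sum>a<N. (w (e a \<otimes>\<^bsub>G k\<^esub> inv\<^bsub>G k\<^esub> e b))\<^sup>2)"
        by (subst hs_norm_square[of _ N], simp add: R_def \<rho>(2), subst sum.swap)
          (auto simp: entry intro!: sum.cong)
      also have "\<dots> = (\<Sum>b<N. \<Sum>g\<in>carrier (G k). (w g)\<^sup>2)"
      proof (intro sum.cong refl)
        fix b assume b: "b \<in> {..<N}"
        have "bij_betw (\<lambda>h. h \<otimes>\<^bsub>G k\<^esub> inv\<^bsub>G k\<^esub> e b) (carrier (G k)) (carrier (G k))"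
          using b by (intro bij_betw_byWitness[of _ "\<lambda>h. h \<otimes>\<^bsub>G k\<^esub> e b"]) (auto simp: Gk.m_assoc)
        then have "bij_betw (\<lambda>a. e a \<otimes>\<^bsub>G k\<^esub> inv\<^bsub>G k\<^esub> e b) {..<N} (carrier (G k))"
          using bij_betw_trans[OF e] by (simp add: comp_def)
        then show "(\<Sum>a<N. (w (e a \<otimes>\<^bsub>G k\<^esub> inv\<^bsub>G k\<^esub> e b))\<^sup>2) = (\<Sum>g\<in>carrier (G k). (w g)\<^sup>2)"
          by (rule sum.reindex_bij_betw)
      qed
      finally have hs: "(hs_norm (R G \<phi> \<mu> \<rho> k (k + j)))\<^sup>2 = real N * (\<Sum>g\<in>carrier (G k). (w g)\<^sup>2)" by simp
      have "(\<Sum>g\<in>carrier (G k). (w g)\<^sup>2) \<le> (\<Sum>g\<in>carrier (G k). w (c k (k + j)) * w g)"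
        unfolding power2_eq_square by (intro sum_mono mult_right_mono) (auto simp: w_def c pushed_noise_nonneg)
      also have "\<dots> = w (c k (k + j))" by (simp add: sum_distrib_left[symmetric] w_def pushed_noise_sum)
      finally have "real N * (\<Sum>g\<in>carrier (G k). (w g)\<^sup>2) \<le> real N * w (c k (k + j))" by (intro mult_left_mono) auto
      then have "real N * (1 - w (c k (k + j))) \<le> real N - (hs_norm (R G \<phi> \<mu> \<rho> k (k + j)))\<^sup>2"
        unfolding hs by (simp add: algebra_simps)
      moreover have "1 * (1 - w (c k (k + j))) \<le> real N * (1 - w (c k (k + j)))"
        using N pushed_noise_le_1 by (intro mult_right_mono) (auto simp: w_def)
      ultimately show "norm (1 - pushed_noise k (k + j) (c k (k + j))) \<le> real (rep_dim G \<rho>) - (hs_norm (R G \<phi> \<mu> \<rho> k (k + j)))\<^sup>2"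
        using pushed_noise_le_1[of k "k + j" "c k (k + j)"] by (simp add: \<rho> w_def)
    qed
  qed
  then show ?thesis unfolding noise_concentrates_def using c(1) by blast
qed

lemma H_all_iff_concentrates:
  "H_det G T \<phi> \<mu> = reps G T \<and> H_freeze G T \<phi> \<mu> = reps G T \<longleftrightarrow> noise_concentrates"
proof -
  have "H_det G T \<phi> \<mu> \<subseteq> reps G T" by (auto simp: H_det_def)
  then show ?thesis
    using H_freeze_subset_H_det concentrates_imp_freeze freeze_imp_concentrates by (metis subset_antisym)
qed

end

section \<open>Consistent marginals\<close>

lemma exists_pmf_with_weights:
  fixes w :: "'b \<Rightarrow> real"
  assumes S: "finite S" and w: "\<And>x. x \<in> S \<Longrightarrow> 0 \<le> w x" "sum w S = 1"
  shows "\<exists>p. set_pmf p \<subseteq> S \<and> (\<forall>x\<in>S. pmf p x = w x)"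
proof -
  define f where "f x = (if x \<in> S then w x else 0)" for x
  have f: "\<And>x. 0 \<le> f x" using w by (simp add: f_def)
  have "(\<integral>\<^sup>+x. ennreal (f x) \<partial>count_space UNIV) = (\<Sum>x\<in>S. ennreal (f x))"
    using S by (intro nn_integral_count_space') (auto simp: f_def)
  also have "\<dots> = ennreal (\<Sum>x\<in>S. f x)" using f by simp
  also have "(\<Sum>x\<in>S. f x) = 1" using w by (simp add: f_def)
  finally have int: "(\<integral>\<^sup>+x. ennreal (f x) \<partial>count_space UNIV) = 1" by simp
  have "pmf (embed_pmf f) x = f x" for x by (rule pmf_embed_pmf[OF f int])
  then show ?thesis by (intro exI[of _ "embed_pmf f"]) (auto simp: set_pmf_eq f_def split: if_splits)
qed

context finite_group_chain
begin

text \<open>Under a solution, \<open>\<kappa> k h g\<close> is the conditional probability of \<open>x k = g\<close> given \<open>x (Suc k) = h\<close>.\<close>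

definition \<kappa> :: "nat \<Rightarrow> 'a \<Rightarrow> 'a \<Rightarrow> real" where
  "\<kappa> k h g = measure (\<mu> k) {z \<in> carrier (G k). \<phi> k h \<otimes>\<^bsub>G k\<^esub> z = g}"

lemma kappa_nonneg: "0 \<le> \<kappa> k h g" by (simp add: \<kappa>_def)

lemma kappa_sum:
  assumes "h \<in> carrier (G (Suc k))" shows "(\<Sum>g\<in>carrier (G k). \<kappa> k h g) = 1"
proof -
  interpret prob_space "\<mu> k" by (rule mu_prob)
  have "(\<integral>z. (1::real) \<partial>\<mu> k) = (\<Sum>g\<in>carrier (G k). measure (\<mu> k) {z \<in> space (\<mu> k). \<phi> k h \<otimes>\<^bsub>G k\<^esub> z = g} *\<^sub>R 1)"
    using assms by (intro integral_finite_valued) (auto simp: group.is_monoid monoid.m_closed)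
  then show ?thesis using prob_space by (simp add: \<kappa>_def)
qed

lemma kappa_mult:
  assumes "h \<in> carrier (G (Suc k))" "z \<in> carrier (G k)"
  shows "\<kappa> k h (\<phi> k h \<otimes>\<^bsub>G k\<^esub> z) = measure (\<mu> k) {z}"
proof -
  have "{y \<in> carrier (G k). \<phi> k h \<otimes>\<^bsub>G k\<^esub> y = \<phi> k h \<otimes>\<^bsub>G k\<^esub> z} = {z}"
    using assms by (auto simp: left_cancel_G)
  then show ?thesis by (simp add: \<kappa>_def)
qed

text \<open>The properties of the one-dimensional laws of a solution.\<close>

definition consistent_marginals :: "(nat \<Rightarrow> 'a \<Rightarrow> real) \<Rightarrow> bool" where
  "consistent_marginals \<nu> \<longleftrightarrow> (\<forall>k. (\<forall>g\<in>carrier (G k). 0 \<le> \<nu> k g) \<and> (\<Sum>g\<in>carrier (G k). \<nu> k g) = 1 \<and>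
     (\<forall>g\<in>carrier (G k). \<nu> k g = (\<Sum>h\<in>carrier (G (Suc k)). \<nu> (Suc k) h * \<kappa> k h g)))"

text \<open>Start at time \<open>n\<close> in the identity and run the equation backwards with the kernels \<open>\<kappa>\<close>.\<close>

lemma finite_horizon_marginals:
  "\<exists>\<nu>. (\<forall>k g. 0 \<le> \<nu> k g \<and> \<nu> k g \<le> 1) \<and> (\<forall>k<n. (\<Sum>g\<in>carrier (G k). \<nu> k g) = 1) \<and>
     (\<forall>k<n. \<forall>g\<in>carrier (G k). \<nu> k g = (\<Sum>h\<in>carrier (G (Suc k)). \<nu> (Suc k) h * \<kappa> k h g))"
proof -
  \<comment> \<open>\<open>W j\<close> is the law at time \<open>n - j\<close>\<close>
  define W where "W = rec_nat (\<lambda>g. if g = \<one>\<^bsub>G n\<^esub> then 1 else 0 :: real)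
    (\<lambda>j w g. if g \<in> carrier (G (n - Suc j)) then (\<Sum>h\<in>carrier (G (n - j)). w h * \<kappa> (n - Suc j) h g) else 0)"
  have W0: "W 0 g = (if g = \<one>\<^bsub>G n\<^esub> then 1 else 0)" for g by (simp add: W_def)
  have WS: "W (Suc j) g = (if g \<in> carrier (G (n - Suc j)) then (\<Sum>h\<in>carrier (G (n - j)). W j h * \<kappa> (n - Suc j) h g) else 0)" for j g
    by (simp add: W_def)
  have W: "(\<forall>g. 0 \<le> W j g) \<and> (\<Sum>g\<in>carrier (G (n - j)). W j g) = 1 \<and> (\<forall>g. g \<notin> carrier (G (n - j)) \<longrightarrow> W j g = 0)" if "j \<le> n" for j
    using that
  proof (induction j)
    case 0
    have "\<one>\<^bsub>G n\<^esub> \<in> carrier (G n)" by (simp add: group.is_monoid monoid.one_closed)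
    then show ?case by (auto simp: W0)
  next
    case (Suc j)
    then have IH: "\<And>g. 0 \<le> W j g" "(\<Sum>g\<in>carrier (G (n - j)). W j g) = 1" by auto
    have nj: "n - j = Suc (n - Suc j)" using Suc.prems by simp
    have "(\<Sum>g\<in>carrier (G (n - Suc j)). W (Suc j) g) =
      (\<Sum>g\<in>carrier (G (n - Suc j)). \<Sum>h\<in>carrier (G (n - j)). W j h * \<kappa> (n - Suc j) h g)"
      by (simp add: WS)
    also have "\<dots> = (\<Sum>h\<in>carrier (G (n - j)). W j h * (\<Sum>g\<in>carrier (G (n - Suc j)). \<kappa> (n - Suc j) h g))"
      by (subst sum.swap) (simp add: sum_distrib_left)
    also have "\<dots> = (\<Sum>h\<in>carrier (G (n - j)). W j h)" by (intro sum.cong refl) (simp add: nj kappa_sum)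
    finally show ?case using IH by (auto simp: WS kappa_nonneg intro!: sum_nonneg mult_nonneg_nonneg)
  qed
  have W1: "W j g \<le> 1" if "j \<le> n" for j g
  proof (cases "g \<in> carrier (G (n - j))")
    case True
    then have "W j g \<le> (\<Sum>g\<in>carrier (G (n - j)). W j g)" using W[OF that] by (intro member_le_sum) auto
    then show ?thesis using W[OF that] by simp
  qed (use W[OF that] in auto)
  define \<nu> where "\<nu> k g = (if k \<le> n then W (n - k) g else 0)" for k g
  have "\<nu> k g = (\<Sum>h\<in>carrier (G (Suc k)). \<nu> (Suc k) h * \<kappa> k h g)" if "k < n" "g \<in> carrier (G k)" for k g
  proof -
    have nk: "n - k = Suc (n - Suc k)" "n - Suc (n - Suc k) = k" "n - (n - Suc k) = Suc k" using that by auto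
    have "W (Suc (n - Suc k)) g = (\<Sum>h\<in>carrier (G (Suc k)). W (n - Suc k) h * \<kappa> k h g)"
      using that unfolding WS nk by simp
    then show ?thesis using that nk(1) by (simp add: \<nu>_def)
  qed
  moreover have "(\<Sum>g\<in>carrier (G k). \<nu> k g) = 1" if "k < n" for k
    using that W[of "n - k"] by (simp add: \<nu>_def)
  moreover have "0 \<le> \<nu> k g \<and> \<nu> k g \<le> 1" for k g using W[of "n - k"] W1[of "n - k"] by (simp add: \<nu>_def)
  ultimately show ?thesis by blast
qed

text \<open>Compactness of a product of unit intervals: the conditions at each time are closed, and finitely
  many of them are satisfied by the marginals for a sufficiently large finite horizon.\<close>

lemma exists_consistent_marginals: "\<exists>\<nu>. consistent_marginals \<nu>"
proof -
  define K :: "(nat \<times> 'a \<Rightarrow> real) set" where "K = (\<Pi>\<^sub>E i\<in>UNIV. {0..1})"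
  define C :: "nat \<Rightarrow> (nat \<times> 'a \<Rightarrow> real) set" where "C k = {x. (\<Sum>g\<in>carrier (G k). x (k, g)) = 1} \<inter>
     (\<Inter>g\<in>carrier (G k). {x. x (k, g) = (\<Sum>h\<in>carrier (G (Suc k)). x (Suc k, h) * \<kappa> k h g)})" for k
  have "compact K"
    using compactin_PiE[of "\<lambda>_. euclideanreal" UNIV "\<lambda>_ :: nat \<times> 'a. {0..1}"]
    by (simp add: K_def euclidean_product_topology)
  moreover have "closed (C k)" for k
    unfolding C_def by (intro closed_Int closed_INT ballI closed_Collect_eq continuous_on_sum continuous_on_mult_right
        continuous_on_product_coordinates continuous_on_const)
  moreover have "K \<inter> (\<Inter>k\<in>I. C k) \<noteq> {}" if "finite I" for I
  proof -
    define n where "n = Suc (Max I)"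
    have n: "k < n" if "k \<in> I" for k using Max_ge[OF \<open>finite I\<close> that] by (simp add: n_def)
    obtain \<nu> where \<nu>: "(\<forall>k g. 0 \<le> \<nu> k g \<and> \<nu> k g \<le> 1) \<and> (\<forall>k<n. (\<Sum>g\<in>carrier (G k). \<nu> k g) = 1) \<and>
        (\<forall>k<n. \<forall>g\<in>carrier (G k). \<nu> k g = (\<Sum>h\<in>carrier (G (Suc k)). \<nu> (Suc k) h * \<kappa> k h g))"
      using finite_horizon_marginals[of n] by (rule exE)
    have "(\<lambda>(k, g). \<nu> k g) \<in> K \<inter> (\<Inter>k\<in>I. C k)"
    proof (intro IntI INT_I)
      show "(\<lambda>(k, g). \<nu> k g) \<in> K" using conjunct1[OF \<nu>] by (auto simp: K_def)
      fix k assume "k \<in> I"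
      show "(\<lambda>(k, g). \<nu> k g) \<in> C k"
        unfolding C_def using \<nu>[THEN conjunct2, THEN conjunct1, rule_format, OF n[OF \<open>k \<in> I\<close>]]
          \<nu>[THEN conjunct2, THEN conjunct2, rule_format, OF n[OF \<open>k \<in> I\<close>]] by simp
    qed
    then show ?thesis by blast
  qed
  ultimately have "K \<inter> (\<Inter>k\<in>UNIV. C k) \<noteq> {}"
    by (intro compact_imp_fip_image[of K UNIV C])
  then obtain x where x: "x \<in> K" "\<And>k. x \<in> C k" by auto
  have "consistent_marginals (\<lambda>k g. x (k, g))"
    unfolding consistent_marginals_def
  proof (intro allI conjI ballI)
    fix k
    have "x (k, g) \<in> {0..1}" for g using x(1) by (auto simp: K_def)
    then show "0 \<le> x (k, g)" for g by auto
    show "(\<Sum>g\<in>carrier (G k). x (k, g)) = 1" using x(2)[of k] unfolding C_def by blast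
    show "x (k, g) = (\<Sum>h\<in>carrier (G (Suc k)). x (Suc k, h) * \<kappa> k h g)" if "g \<in> carrier (G k)" for g
      using x(2)[of k] that unfolding C_def by blast
  qed
  then show ?thesis by blast
qed

end

section \<open>Existence of a solution\<close>

context finite_group_chain
begin

text \<open>The probability that a chain which starts at time \<open>n\<close> with law \<open>\<nu> n\<close> and runs backwards with the
  kernels \<open>\<kappa>\<close> follows \<open>a\<close> down to time \<open>k\<close>.\<close>

definition path_weight :: "(nat \<Rightarrow> 'a \<Rightarrow> real) \<Rightarrow> nat \<Rightarrow> nat \<Rightarrow> (nat \<Rightarrow> 'a) \<Rightarrow> real" where
  "path_weight \<nu> k n a = \<nu> n (a n) * (\<Prod>i\<in>{k..<n}. \<kappa> i (a (Suc i)) (a i))"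

text \<open>The forward kernels constructed below live on the carriers, but their samples range over the whole
  type. Resetting the exceptional samples, which have probability zero, keeps every path in \<open>\<Omega>\<close>.\<close>

definition reset :: "nat \<Rightarrow> 'a \<Rightarrow> 'a" where
  "reset n y = (if y \<in> carrier (G n) then y else \<one>\<^bsub>G n\<^esub>)"

lemma reset_closed [simp]: "reset n y \<in> carrier (G n)"
  by (auto simp: reset_def group.is_monoid monoid.one_closed)

lemma measure_reset:
  assumes "set_pmf p \<subseteq> carrier (G n)" "g \<in> carrier (G n)"
  shows "measure (measure_pmf p) {y. reset n y = g} = pmf p g"
proof -
  have "measure (measure_pmf p) {y. reset n y = g} = measure (measure_pmf p) {g}"
    using assms by (intro measure_pmf.finite_measure_eq_AE) (auto simp: AE_measure_pmf_iff reset_def)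
  then show ?thesis by (simp add: measure_pmf_single)
qed

context
  fixes \<nu> assumes \<nu>: "consistent_marginals \<nu>"
begin

lemma nu_nonneg: "g \<in> carrier (G k) \<Longrightarrow> 0 \<le> \<nu> k g"
  and nu_sum: "(\<Sum>g\<in>carrier (G k). \<nu> k g) = 1"
  and nu_step: "g \<in> carrier (G k) \<Longrightarrow> \<nu> k g = (\<Sum>h\<in>carrier (G (Suc k)). \<nu> (Suc k) h * \<kappa> k h g)"
  using \<nu> unfolding consistent_marginals_def by blast+

text \<open>Bayes' rule: the probability to move from \<open>g\<close> at time \<open>n\<close> to \<open>h\<close> at time \<open>Suc n\<close> is
  \<open>\<nu> (Suc n) h \<kappa> n h g / \<nu> n g\<close>. If \<open>\<nu> n g = 0\<close>, then consistency makes the right-hand side of the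
  asserted identity vanish for all \<open>h\<close>, and any law on the carrier will do.\<close>

lemma exists_forward_kernels:
  "\<exists>p. (\<forall>n g. set_pmf (p n g) \<subseteq> carrier (G n)) \<and> (\<forall>g. \<forall>x\<in>carrier (G 0). pmf (p 0 g) x = \<nu> 0 x) \<and>
     (\<forall>n. \<forall>g\<in>carrier (G n). \<forall>h\<in>carrier (G (Suc n)). \<nu> n g * pmf (p (Suc n) g) h = \<nu> (Suc n) h * \<kappa> n h g)"
proof -
  have p0: "\<exists>p. set_pmf p \<subseteq> carrier (G 0) \<and> (\<forall>x\<in>carrier (G 0). pmf p x = \<nu> 0 x)"
    by (intro exists_pmf_with_weights) (auto simp: nu_nonneg nu_sum)
  have pS: "\<exists>p. set_pmf p \<subseteq> carrier (G (Suc n)) \<and>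
      (g \<in> carrier (G n) \<longrightarrow> (\<forall>h\<in>carrier (G (Suc n)). \<nu> n g * pmf p h = \<nu> (Suc n) h * \<kappa> n h g))" for n g
  proof (cases "g \<in> carrier (G n) \<and> \<nu> n g > 0")
    case True
    have "\<exists>p. set_pmf p \<subseteq> carrier (G (Suc n)) \<and> (\<forall>h\<in>carrier (G (Suc n)). pmf p h = \<nu> (Suc n) h * \<kappa> n h g / \<nu> n g)"
      using True nu_step[of g n] by (intro exists_pmf_with_weights)
        (auto simp: nu_nonneg kappa_nonneg sum_divide_distrib[symmetric])
    then obtain p where p: "set_pmf p \<subseteq> carrier (G (Suc n))"
      "\<forall>h\<in>carrier (G (Suc n)). pmf p h = \<nu> (Suc n) h * \<kappa> n h g / \<nu> n g" by blast
    then show ?thesis using True by (intro exI[of _ p]) auto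
  next
    case False
    have "\<nu> (Suc n) h * \<kappa> n h g = 0" "\<nu> n g = 0" if g: "g \<in> carrier (G n)" and h: "h \<in> carrier (G (Suc n))" for h
    proof -
      show z: "\<nu> n g = 0" using False g nu_nonneg[OF g] by auto
      have "(\<Sum>h\<in>carrier (G (Suc n)). \<nu> (Suc n) h * \<kappa> n h g) = 0" using nu_step[OF g] z by simp
      then show "\<nu> (Suc n) h * \<kappa> n h g = 0"
        using h by (subst (asm) sum_nonneg_eq_0_iff) (auto simp: nu_nonneg kappa_nonneg)
    qed
    then show ?thesis
      by (intro exI[of _ "return_pmf \<one>\<^bsub>G (Suc n)\<^esub>"]) (auto simp: group.is_monoid monoid.one_closed)
  qed
  \<comment> \<open>one specification for the initial law and for all transitions, so that a single choice suffices\<close>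
  define Q where "Q n g p \<longleftrightarrow> set_pmf p \<subseteq> carrier (G n) \<and>
     (case n of 0 \<Rightarrow> \<forall>x\<in>carrier (G 0). pmf p x = \<nu> 0 x
       | Suc m \<Rightarrow> g \<in> carrier (G m) \<longrightarrow> (\<forall>h\<in>carrier (G (Suc m)). \<nu> m g * pmf p h = \<nu> (Suc m) h * \<kappa> m h g))" for n g p
  define p where "p n g = (SOME p. Q n g p)" for n g
  have "\<exists>p. Q n g p" for n g using p0 pS[of _ g] by (cases n) (simp_all add: Q_def)
  then have "Q n g (p n g)" for n g unfolding p_def by (rule someI_ex)
  from this this[of 0] this[of "Suc n" for n] show ?thesis
    by (intro exI[of _ p]) (simp add: Q_def)
qed

text \<open>The time-reversed chain runs forwards from time 0 and so can be realised by independent random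
  maps on an infinite product space. A cylinder depends on finitely many of these maps, and Bayes'
  rule makes the product of their probabilities telescope to \<open>path_weight\<close>.\<close>

lemma exists_chain_measure:
  "\<exists>P. borel_prob_on (product_topology T UNIV) P \<and>
     (\<forall>n. \<forall>a\<in>\<Omega>. measure P {x \<in> \<Omega>. \<forall>i\<le>n. x i = a i} = path_weight \<nu> 0 n a)"
proof -
  obtain p where p: "(\<forall>n g. set_pmf (p n g) \<subseteq> carrier (G n)) \<and>
      (\<forall>g. \<forall>x\<in>carrier (G 0). pmf (p 0 g) x = \<nu> 0 x) \<and>
      (\<forall>n. \<forall>g\<in>carrier (G n). \<forall>h\<in>carrier (G (Suc n)). \<nu> n g * pmf (p (Suc n) g) h = \<nu> (Suc n) h * \<kappa> n h g)"
    using exists_forward_kernels by (rule exE)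
  note p_set = p[THEN conjunct1, rule_format]
    and p0 = p[THEN conjunct2, THEN conjunct1, rule_format]
    and pS = p[THEN conjunct2, THEN conjunct2, rule_format]
  \<comment> \<open>independent random maps: \<open>\<omega> (n, g)\<close> is the state at time \<open>n\<close> if the previous state is \<open>g\<close>\<close>
  define M :: "nat \<times> 'a \<Rightarrow> 'a measure" where "M = (\<lambda>(n, g). measure_pmf (p n g))"
  interpret product_prob_space M UNIV
  proof (rule product_prob_spaceI)
    show "prob_space (M i)" for i
      by (cases i) (simp add: M_def measure_pmf.prob_space_axioms)
  qed
  let ?M = "Pi\<^sub>M UNIV M"
  have spM [simp]: "space ?M = UNIV" by (auto simp: space_PiM M_def split: prod.splits)
  define X :: "(nat \<times> 'a \<Rightarrow> 'a) \<Rightarrow> nat \<Rightarrow> 'a" where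
    "X \<omega> = rec_nat (reset 0 (\<omega> (0, undefined))) (\<lambda>n g. reset (Suc n) (\<omega> (Suc n, g)))" for \<omega>
  have X0: "X \<omega> 0 = reset 0 (\<omega> (0, undefined))" and XS: "X \<omega> (Suc n) = reset (Suc n) (\<omega> (Suc n, X \<omega> n))" for \<omega> n
    by (simp_all add: X_def)
  have Xc: "X \<omega> n \<in> carrier (G n)" for \<omega> n by (cases n) (simp_all add: X0 XS)
  then have XO: "X \<omega> \<in> \<Omega>" for \<omega> unfolding \<Omega>_def by (auto simp del: \<Omega>_def[symmetric])
  \<comment> \<open>the initial map is constant, so the state before time 0 is arbitrary\<close>
  define prev where "prev a n = (case n of 0 \<Rightarrow> undefined | Suc m \<Rightarrow> a m)" for a :: "nat \<Rightarrow> 'a" and n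
  define J where "J a n = (\<lambda>i. (i, prev a i)) ` {..n}" for a n
  have X_iff: "(\<forall>i\<le>n. X \<omega> i = a i) \<longleftrightarrow> (\<forall>i\<le>n. reset i (\<omega> (i, prev a i)) = a i)" for \<omega> a n
  proof (induction n)
    case (Suc n)
    have "(\<forall>i\<le>Suc n. X \<omega> i = a i) \<longleftrightarrow> (\<forall>i\<le>n. X \<omega> i = a i) \<and> X \<omega> (Suc n) = a (Suc n)"
      by (auto simp: le_Suc_eq)
    also have "\<dots> \<longleftrightarrow> (\<forall>i\<le>n. X \<omega> i = a i) \<and> reset (Suc n) (\<omega> (Suc n, a n)) = a (Suc n)"
      by (auto simp: XS)
    also have "\<dots> \<longleftrightarrow> (\<forall>i\<le>Suc n. reset i (\<omega> (i, prev a i)) = a i)"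
      unfolding Suc.IH by (auto simp: le_Suc_eq prev_def)
    finally show ?case .
  qed (simp add: X0 prev_def)
  have cyl_eq: "{\<omega>. \<forall>i\<le>n. X \<omega> i = a i} = {\<omega>\<in>space ?M. \<forall>j\<in>J a n. \<omega> j \<in> {y. reset (fst j) y = a (fst j)}}" for a n
    unfolding X_iff by (auto simp: J_def)
  have sM [simp]: "sets (M j) = UNIV" for j by (simp add: M_def split: prod.splits)
  have cyl_sets: "{\<omega>. \<forall>i\<le>n. X \<omega> i = a i} \<in> sets ?M" for a n
    unfolding cyl_eq by (rule sets.sets_Collect_finite_All, rule sets_Collect_single') (auto simp: J_def)
  have cyl_measure: "measure ?M {\<omega>. \<forall>i\<le>n. X \<omega> i = a i} = path_weight \<nu> 0 n a" if a: "a \<in> \<Omega>" for a n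
  proof -
    have "emeasure ?M {\<omega>. \<forall>i\<le>n. X \<omega> i = a i} = (\<Prod>j\<in>J a n. emeasure (M j) {y. reset (fst j) y = a (fst j)})"
      unfolding cyl_eq by (rule emeasure_PiM_Collect) (auto simp: J_def)
    also have "\<dots> = (\<Prod>i\<le>n. emeasure (M (i, prev a i)) {y. reset i y = a i})"
      unfolding J_def by (subst prod.reindex) (auto simp: inj_on_def)
    also have "\<dots> = (\<Prod>i\<le>n. ennreal (pmf (p i (prev a i)) (a i)))"
      using measure_reset[OF p_set] a by (intro prod.cong refl) (simp add: M_def measure_pmf.emeasure_eq_measure)
    also have "\<dots> = ennreal (\<Prod>i\<le>n. pmf (p i (prev a i)) (a i))"
      by (intro prod_ennreal) simp
    finally have "measure ?M {\<omega>. \<forall>i\<le>n. X \<omega> i = a i} = (\<Prod>i\<le>n. pmf (p i (prev a i)) (a i))"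
      by (simp add: measure_def prod_nonneg)
    also have "\<dots> = path_weight \<nu> 0 n a"
    proof (induction n)
      case 0
      then show ?case using a by (simp add: path_weight_def p0)
    next
      case (Suc n)
      have "(\<Prod>i\<le>Suc n. pmf (p i (prev a i)) (a i)) = path_weight \<nu> 0 n a * pmf (p (Suc n) (a n)) (a (Suc n))"
        using Suc.IH by (simp add: prev_def)
      also have "\<dots> = (\<nu> n (a n) * pmf (p (Suc n) (a n)) (a (Suc n))) * (\<Prod>i\<in>{0..<n}. \<kappa> i (a (Suc i)) (a i))"
        by (simp add: path_weight_def)
      also have "\<dots> = path_weight \<nu> 0 (Suc n) a"
        using a by (simp add: pS path_weight_def)
      finally show ?case .
    qed
    finally show ?thesis .
  qed
  \<comment> \<open>open sets of the path space are countable unions of cylinders\<close>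
  define cyl where "cyl n a = {x \<in> \<Omega>. \<forall>i\<le>n. x i = a i}" for n and a :: "nat \<Rightarrow> 'a"
  have cyl_vimage: "X -` cyl n a = {\<omega>. \<forall>i\<le>n. X \<omega> i = a i}" for n a using XO by (auto simp: cyl_def)
  have countable_cyl: "countable (\<Union>n. cyl n ` \<Omega>)"
  proof (rule countable_UN)
    fix n
    have "cyl n a \<in> cyl n ` (\<Pi>\<^sub>E i\<in>{..n}. carrier (G i))" if "a \<in> \<Omega>" for a
      using that by (intro image_eqI[of _ _ "restrict a {..n}"]) (auto simp: cyl_def)
    then have "cyl n ` \<Omega> \<subseteq> cyl n ` (\<Pi>\<^sub>E i\<in>{..n}. carrier (G i))" by blast
    then have "finite (cyl n ` \<Omega>)" by (rule finite_subset) (intro finite_imageI finite_PiE, auto)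
    then show "countable (cyl n ` \<Omega>)" by (rule countable_finite)
  qed auto
  have open_union: "U = \<Union>{C \<in> (\<Union>n. cyl n ` \<Omega>). C \<subseteq> U}" if U: "openin (product_topology T UNIV) U" for U
  proof
    show "U \<subseteq> \<Union>{C \<in> (\<Union>n. cyl n ` \<Omega>). C \<subseteq> U}"
    proof
      fix y assume y: "y \<in> U"
      then obtain V where V: "finite {i. V i \<noteq> carrier (G i)}" "y \<in> (\<Pi>\<^sub>E i\<in>UNIV. V i)" "(\<Pi>\<^sub>E i\<in>UNIV. V i) \<subseteq> U"
        using U unfolding openin_product_topology_alt by auto
      have yO: "y \<in> \<Omega>" using y openin_subset[OF U] by auto
      obtain n where n: "\<And>i. V i \<noteq> carrier (G i) \<Longrightarrow> i \<le> n"
        using V(1) unfolding finite_nat_set_iff_bounded_le by auto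
      have "cyl n y \<subseteq> (\<Pi>\<^sub>E i\<in>UNIV. V i)"
      proof
        fix x assume x: "x \<in> cyl n y"
        have "x i \<in> V i" for i
        proof (cases "i \<le> n")
          case True
          then show ?thesis using x V(2) by (auto simp: cyl_def PiE_iff)
        next
          case False
          then have "V i = carrier (G i)" using n by blast
          then show ?thesis using x by (auto simp: cyl_def)
        qed
        then show "x \<in> (\<Pi>\<^sub>E i\<in>UNIV. V i)" by auto
      qed
      then show "y \<in> \<Union>{C \<in> (\<Union>n. cyl n ` \<Omega>). C \<subseteq> U}"
        using V(3) yO by (intro UnionI[of "cyl n y"]) (auto simp: cyl_def)
    qed
  qed auto
  have X_meas: "X \<in> ?M \<rightarrow>\<^sub>M borel_of (product_topology T UNIV)"
    unfolding borel_of_def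
  proof (rule measurable_measure_of)
    show "{U. openin (product_topology T UNIV) U} \<subseteq> Pow (topspace (product_topology T UNIV))"
      using openin_subset by fastforce
    show "X \<in> space ?M \<rightarrow> topspace (product_topology T UNIV)" using XO by simp
    fix U assume "U \<in> {U. openin (product_topology T UNIV) U}"
    then have U: "U = \<Union>{C \<in> (\<Union>n. cyl n ` \<Omega>). C \<subseteq> U}" by (intro open_union) simp
    have "X -` U = X -` \<Union>{C \<in> (\<Union>n. cyl n ` \<Omega>). C \<subseteq> U}" using U by (rule arg_cong)
    then have "X -` U \<inter> space ?M = (\<Union>C\<in>{C \<in> (\<Union>n. cyl n ` \<Omega>). C \<subseteq> U}. X -` C)"
      by (simp add: vimage_Union)
    also have "\<dots> \<in> sets ?M"
    proof (rule sets.countable_UN')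
      show "countable {C \<in> (\<Union>n. cyl n ` \<Omega>). C \<subseteq> U}"
        by (rule countable_subset[OF _ countable_cyl]) auto
    qed (auto simp: cyl_vimage cyl_sets)
    finally show "X -` U \<inter> space ?M \<in> sets ?M" .
  qed
  define P where "P = distr ?M (borel_of (product_topology T UNIV)) X"
  have "borel_prob_on (product_topology T UNIV) P"
    unfolding borel_prob_on_def P_def using P.prob_space_distr[OF X_meas] by simp
  moreover have "measure P {x \<in> \<Omega>. \<forall>i\<le>n. x i = a i} = path_weight \<nu> 0 n a" if "a \<in> \<Omega>" for n a
  proof -
    have "cyl n a = (\<Inter>i\<in>{..n}. {x \<in> \<Omega>. x i = a i})" by (auto simp: cyl_def)
    also have "\<dots> \<in> sets (borel_of (product_topology T UNIV))"
      by (intro sets.finite_INT coordinate_in_borel) auto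
    finally have "measure P (cyl n a) = measure ?M (X -` cyl n a \<inter> space ?M)"
      unfolding P_def by (rule measure_distr[OF X_meas])
    then have "measure P {x \<in> \<Omega>. \<forall>i\<le>n. x i = a i} = measure ?M (X -` cyl n a)"
      unfolding spM by (simp only: cyl_def Int_UNIV_right)
    then show ?thesis using cyl_measure[OF that] by (simp add: cyl_vimage)
  qed
  ultimately show ?thesis by (intro exI[of _ P]) simp
qed

text \<open>Summation over the state at the lowest time removes its kernel, which has total mass one.\<close>

lemma segment_weight:
  assumes P: "borel_prob_on (product_topology T UNIV) P"
    and cyl: "\<forall>n. \<forall>a\<in>\<Omega>. measure P {x \<in> \<Omega>. \<forall>i\<le>n. x i = a i} = path_weight \<nu> 0 n a"
    and a: "a \<in> \<Omega>" and kn: "k \<le> n"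
  shows "measure P {x \<in> \<Omega>. \<forall>i\<in>{k..n}. x i = a i} = path_weight \<nu> k n a"
  using kn a
proof (induction k arbitrary: a)
  case 0
  then show ?case using cyl by (simp add: atLeast0AtMost Ball_def)
next
  case (Suc k)
  interpret prob_space P by (rule P_prob[OF P])
  have meas: "{x \<in> \<Omega>. \<forall>i\<in>S. x i = b i} \<in> sets P" if "finite S" for S b
    using sets.sets_Collect_finite_All[OF _ that, of P "\<lambda>i x. x i = b i"] coordinate_in_borel[of "\<lambda>y. y = z" for z]
    by (simp add: space_P[OF P] sets_P[OF P])
  let ?A = "{x \<in> \<Omega>. \<forall>i\<in>{Suc k..n}. x i = a i}"
  have upd: "a(k := g) \<in> \<Omega>" if "g \<in> carrier (G k)" for g
    using Suc.prems(2) that unfolding \<Omega>_def by (auto simp: PiE_iff simp del: \<Omega>_def[symmetric])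
  have "measure P ?A = (\<Sum>g\<in>carrier (G k). measure P (?A \<inter> {x \<in> \<Omega>. x k = g}))"
    using measure_eq_sum_fibres[of ?A "carrier (G k)" "\<lambda>x. x k"] coordinate_in_borel[of "\<lambda>y. y = z" for z] meas
    by (simp add: space_P[OF P] sets_P[OF P])
  also have "\<dots> = (\<Sum>g\<in>carrier (G k). path_weight \<nu> k n (a(k := g)))"
  proof (intro sum.cong refl)
    fix g assume g: "g \<in> carrier (G k)"
    have "?A \<inter> {x \<in> \<Omega>. x k = g} = {x \<in> \<Omega>. \<forall>i\<in>{k..n}. x i = (a(k := g)) i}"
      using Suc.prems(1) by (auto simp: Suc_le_eq le_less)
    then show "measure P (?A \<inter> {x \<in> \<Omega>. x k = g}) = path_weight \<nu> k n (a(k := g))"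
      using Suc.IH[OF _ upd[OF g]] Suc.prems(1) by (simp del: fun_upd_apply)
  qed
  also have "\<dots> = (\<Sum>g\<in>carrier (G k). path_weight \<nu> (Suc k) n a * \<kappa> k (a (Suc k)) g)"
  proof (intro sum.cong refl)
    fix g
    have "{k..<n} = insert k {Suc k..<n}" using Suc.prems(1) by auto
    then show "path_weight \<nu> k n (a(k := g)) = path_weight \<nu> (Suc k) n a * \<kappa> k (a (Suc k)) g"
      using Suc.prems(1) by (simp add: path_weight_def mult_ac)
  qed
  also have "\<dots> = path_weight \<nu> (Suc k) n a"
    using kappa_sum[of "a (Suc k)" k] Suc.prems(2) by (simp add: sum_distrib_left[symmetric])
  finally show ?case .
qed

text \<open>The sets that fix all coordinates from \<open>Suc k\<close> to some \<open>n\<close>. Unlike the sets that restrict a single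
  coordinate, they are closed under intersection, up to the empty set.\<close>

lemma segment_generator:
  "sets (tail_sigma T k) = sigma_sets \<Omega> (insert {} {{x \<in> \<Omega>. \<forall>i\<in>{Suc k..n}. x i = a i} | n a. Suc k \<le> n \<and> a \<in> \<Omega>})"
    (is "_ = sigma_sets \<Omega> ?E")
proof
  have sa: "sigma_algebra \<Omega> (sigma_sets \<Omega> ?E)" by (rule sigma_algebra_sigma_sets) auto
  show "sets (tail_sigma T k) \<subseteq> sigma_sets \<Omega> ?E"
    unfolding sets_tail
  proof (rule sigma_algebra.sigma_sets_subset[OF sa], clarify)
    fix j A assume j: "k < j" and A: "A \<subseteq> carrier (G j)"
    let ?R = "(\<lambda>a. {x \<in> \<Omega>. \<forall>i\<in>{Suc k..j}. x i = a i}) ` {a \<in> \<Omega>. a j \<in> A}"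
    have "?R \<subseteq> (\<lambda>a. {x \<in> \<Omega>. \<forall>i\<in>{Suc k..j}. x i = a i}) ` (\<Pi>\<^sub>E i\<in>{Suc k..j}. carrier (G i))"
    proof clarify
      fix a assume "a \<in> \<Omega>"
      then show "{x \<in> \<Omega>. \<forall>i\<in>{Suc k..j}. x i = a i} \<in> (\<lambda>a. {x \<in> \<Omega>. \<forall>i\<in>{Suc k..j}. x i = a i}) ` (\<Pi>\<^sub>E i\<in>{Suc k..j}. carrier (G i))"
        by (intro image_eqI[of _ _ "restrict a {Suc k..j}"]) auto
    qed
    then have "finite ?R" by (rule finite_subset) (intro finite_imageI finite_PiE, auto)
    moreover have "?R \<subseteq> sigma_sets \<Omega> ?E"
    proof (intro image_subsetI sigma_sets.Basic insertI2 CollectI)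
      fix a assume "a \<in> {a \<in> \<Omega>. a j \<in> A}"
      then show "\<exists>n b. {x \<in> \<Omega>. \<forall>i\<in>{Suc k..j}. x i = a i} = {x \<in> \<Omega>. \<forall>i\<in>{Suc k..n}. x i = b i} \<and> Suc k \<le> n \<and> b \<in> \<Omega>"
        using j by (intro exI[of _ j] exI[of _ a]) auto
    qed
    ultimately have "\<Union>?R \<in> sigma_sets \<Omega> ?E"
      by (rule ring_of_sets.finite_Union[OF Sigma_Algebra.algebra.axioms(1)[OF sigma_algebra.axioms(1)[OF sa]]])
    also have "\<Union>?R = (\<lambda>x. x j) -` A \<inter> \<Omega>" using j by auto
    finally show "(\<lambda>x. x j) -` A \<inter> \<Omega> \<in> sigma_sets \<Omega> ?E" .
  qed
  have "sigma_algebra \<Omega> (sets (tail_sigma T k))"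
    using sets.sigma_algebra_axioms[of "tail_sigma T k"] by simp
  then show "sigma_sets \<Omega> ?E \<subseteq> sets (tail_sigma T k)"
  proof (rule sigma_algebra.sigma_sets_subset)
    have "{x \<in> \<Omega>. \<forall>i\<in>{Suc k..n}. x i = a i} \<in> sets (tail_sigma T k)" for n a
      using sets.sets_Collect_finite_All[of "{Suc k..n}" "tail_sigma T k" "\<lambda>i x. x i = a i"] coordinate_in_tail[of k i "\<lambda>y. y = z" for i z]
      by simp
    then show "?E \<subseteq> sets (tail_sigma T k)" by auto
  qed
qed

text \<open>On a segment that fixes \<open>x (Suc k)\<close>, prescribing the noise at \<open>k\<close> means prescribing \<open>x k\<close>, which
  contributes the further factor \<open>\<kappa> k h (\<phi> k h z) = \<mu> k {z}\<close> with \<open>h = x (Suc k)\<close>. Dynkin's theorem extends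
  the product formula from segments to all tail events.\<close>

lemma chain_noise_independent:
  assumes P: "borel_prob_on (product_topology T UNIV) P"
    and cyl: "\<forall>n. \<forall>a\<in>\<Omega>. measure P {x \<in> \<Omega>. \<forall>i\<le>n. x i = a i} = path_weight \<nu> 0 n a"
  shows "noise_independent P"
  unfolding noise_independent_def
proof (intro allI ballI)
  fix k z A assume z: "z \<in> carrier (G k)" and A: "A \<in> sets (tail_sigma T k)"
  interpret prob_space P by (rule P_prob[OF P])
  note seg = segment_weight[OF P cyl]
  let ?E = "insert {} {{x \<in> \<Omega>. \<forall>i\<in>{Suc k..n}. x i = a i} | n a. Suc k \<le> n \<and> a \<in> \<Omega>}"
  let ?Z = "{x \<in> \<Omega>. Z G \<phi> k x = z}"
  have ZP: "?Z \<in> sets P" using noise_in_borel sets_P[OF P] by simp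
  have base: "measure P ({x \<in> \<Omega>. \<forall>i\<in>{Suc k..n}. x i = a i} \<inter> ?Z) = measure (\<mu> k) {z} * measure P {x \<in> \<Omega>. \<forall>i\<in>{Suc k..n}. x i = a i}"
    if n: "Suc k \<le> n" and a: "a \<in> \<Omega>" for n a
  proof -
    \<comment> \<open>the path through \<open>a\<close> whose noise at time \<open>k\<close> is \<open>z\<close>\<close>
    define b where "b = a(k := \<phi> k (a (Suc k)) \<otimes>\<^bsub>G k\<^esub> z)"
    have b: "b \<in> \<Omega>"
      using a z Omega_closed[OF a, of "Suc k"] unfolding b_def \<Omega>_def
      by (auto simp: PiE_iff group.is_monoid monoid.m_closed simp del: \<Omega>_def[symmetric])
    have "{x \<in> \<Omega>. \<forall>i\<in>{Suc k..n}. x i = a i} \<inter> ?Z = {x \<in> \<Omega>. \<forall>i\<in>{k..n}. x i = b i}" (is "?l = ?r")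
    proof -
      have split: "{k..n} = insert k {Suc k..n}" using n by auto
      have "Z G \<phi> k x = z \<longleftrightarrow> x k = b k" if "x \<in> \<Omega>" "\<forall>i\<in>{Suc k..n}. x i = a i" for x
        using that n by (simp add: noise_eq_iff[OF _ z] b_def)
      moreover have "b i = a i" if "i \<in> {Suc k..n}" for i using that by (simp add: b_def)
      ultimately show ?thesis unfolding split by auto
    qed
    then have "measure P ({x \<in> \<Omega>. \<forall>i\<in>{Suc k..n}. x i = a i} \<inter> ?Z) = path_weight \<nu> k n b"
      using seg[OF b, of k n] n by simp
    also have "\<dots> = \<kappa> k (a (Suc k)) (\<phi> k (a (Suc k)) \<otimes>\<^bsub>G k\<^esub> z) * path_weight \<nu> (Suc k) n a"
    proof -
      have "{k..<n} = insert k {Suc k..<n}" using n by auto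
      then show ?thesis using n by (simp add: path_weight_def b_def mult_ac)
    qed
    also have "\<dots> = measure (\<mu> k) {z} * path_weight \<nu> (Suc k) n a" using a z by (simp add: kappa_mult)
    finally show ?thesis using seg[OF a n] by simp
  qed
  have Zm: "measure P ?Z = measure (\<mu> k) {z}"
  proof -
    let ?S = "carrier (G (Suc k))" and ?C = "\<lambda>h. {x \<in> \<Omega>. x (Suc k) = h}"
    have C: "?C h \<in> sets P" for h using coordinate_in_borel sets_P[OF P] by simp
    have fibre: "measure P (?C h \<inter> ?Z) = measure (\<mu> k) {z} * measure P (?C h)" if "h \<in> ?S" for h
    proof -
      have "(\<lambda>i. if i = Suc k then h else \<one>\<^bsub>G i\<^esub>) \<in> \<Omega>"
        using that unfolding \<Omega>_def by (auto simp: group.is_monoid monoid.one_closed simp del: \<Omega>_def[symmetric])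
      from base[OF order_refl this] show ?thesis by simp
    qed
    have part: "measure P B = (\<Sum>h\<in>?S. measure P (B \<inter> ?C h))" if "B \<in> sets P" for B
      using measure_eq_sum_fibres[OF that, of ?S "\<lambda>x. x (Suc k)"] C by (simp add: space_P[OF P])
    have "\<Omega> \<in> sets P" using sets.top[of P] by (simp add: space_P[OF P])
    have "(\<Sum>h\<in>?S. measure P (?C h)) = measure P \<Omega>"
      by (subst part[OF \<open>\<Omega> \<in> sets P\<close>]) (intro sum.cong refl arg_cong[of _ _ "measure P"], auto)
    then have "(\<Sum>h\<in>?S. measure P (?C h)) = 1" using prob_space by (simp add: space_P[OF P])
    then show ?thesis
      by (subst part[OF ZP]) (simp add: fibre Int_commute[of ?Z] sum_distrib_left[symmetric])
  qed
  have stable: "Int_stable ?E"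
  proof (rule Int_stableI)
    have *: "{x \<in> \<Omega>. \<forall>i\<in>{Suc k..n}. x i = a i} \<inter> {x \<in> \<Omega>. \<forall>i\<in>{Suc k..m}. x i = b i} \<in>
        insert {} {{x \<in> \<Omega>. \<forall>i\<in>{Suc k..m}. x i = b i}}" if "n \<le> m" for n m a b
    proof (cases "\<forall>i\<in>{Suc k..n}. a i = b i")
      case True
      then have "{x \<in> \<Omega>. \<forall>i\<in>{Suc k..n}. x i = a i} \<inter> {x \<in> \<Omega>. \<forall>i\<in>{Suc k..m}. x i = b i} = {x \<in> \<Omega>. \<forall>i\<in>{Suc k..m}. x i = b i}"
        using that by auto
      then show ?thesis by simp
    next
      case False
      then obtain i where i: "i \<in> {Suc k..n}" "a i \<noteq> b i" by blast
      moreover have "i \<in> {Suc k..m}" using i(1) that by simp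
      ultimately have "{x \<in> \<Omega>. \<forall>i\<in>{Suc k..n}. x i = a i} \<inter> {x \<in> \<Omega>. \<forall>i\<in>{Suc k..m}. x i = b i} = {}"
        by fastforce
      then show ?thesis by simp
    qed
    fix C D assume CD: "C \<in> ?E" "D \<in> ?E"
    show "C \<inter> D \<in> ?E"
    proof (cases "C = {} \<or> D = {}")
      case False
      obtain n a where C: "C = {x \<in> \<Omega>. \<forall>i\<in>{Suc k..n}. x i = a i}" "Suc k \<le> n" "a \<in> \<Omega>"
        using CD(1) False by blast
      obtain m b where D: "D = {x \<in> \<Omega>. \<forall>i\<in>{Suc k..m}. x i = b i}" "Suc k \<le> m" "b \<in> \<Omega>"
        using CD(2) False by blast
      have "C \<inter> D \<in> {{}, C, D}"
        using *[of n m a b] *[of m n b a] unfolding C(1) D(1) by (cases "n \<le> m") (auto simp: Int_commute)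
      then show ?thesis using CD by auto
    qed auto
  qed
  have mem: "A \<in> sigma_sets \<Omega> ?E" using A by (simp only: segment_generator)
  have sub: "?E \<subseteq> Pow \<Omega>" by auto
  from stable sub mem show "measure P (A \<inter> ?Z) = measure (\<mu> k) {z} * measure P A"
  proof (induction rule: sigma_sets_induct_disjoint)
    case (basic A)
    then show ?case using base by auto
  next
    case empty
    then show ?case by simp
  next
    case (compl A)
    have AP: "A \<in> sets P" using compl(1) unfolding segment_generator[symmetric] by (rule tail_in_P[OF P])
    have "(\<Omega> - A) \<inter> ?Z = ?Z - (A \<inter> ?Z)" by auto
    then have 1: "measure P ((\<Omega> - A) \<inter> ?Z) = measure P ?Z - measure P (A \<inter> ?Z)"
      using AP ZP by (simp add: finite_measure_Diff)
    have 2: "measure P (\<Omega> - A) = 1 - measure P A"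
      using prob_compl[OF AP] by (simp add: space_P[OF P])
    show ?case unfolding 1 2 Zm compl(2) by (simp add: right_diff_distrib)
  next
    case (union A)
    have AP: "A i \<in> sets P" for i using union(2) unfolding segment_generator[symmetric] by (auto intro: tail_in_P[OF P])
    have "(\<lambda>i. measure P (A i \<inter> ?Z)) sums measure P (\<Union>i. A i \<inter> ?Z)"
    proof (rule finite_measure_UNION)
      show "disjoint_family (\<lambda>i. A i \<inter> ?Z)" using union(1) by (auto simp: disjoint_family_on_def)
    qed (use AP ZP in auto)
    moreover have "(\<lambda>i. measure (\<mu> k) {z} * measure P (A i)) sums (measure (\<mu> k) {z} * measure P (\<Union>i. A i))"
      using AP union(1) by (intro sums_mult finite_measure_UNION) auto
    ultimately have "measure P (\<Union>i. A i \<inter> ?Z) = measure (\<mu> k) {z} * measure P (\<Union>i. A i)"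
      unfolding union(3) by (rule sums_unique2)
    moreover have "(\<Union>i. A i) \<inter> ?Z = (\<Union>i. A i \<inter> ?Z)" by auto
    ultimately show ?case by (simp only:)
  qed
qed

end

lemma solutions_nonempty: "solutions G T \<phi> \<mu> \<noteq> {}"
proof -
  obtain \<nu> where \<nu>: "consistent_marginals \<nu>" using exists_consistent_marginals by blast
  obtain P where "borel_prob_on (product_topology T UNIV) P \<and>
     (\<forall>n. \<forall>a\<in>\<Omega>. measure P {x \<in> \<Omega>. \<forall>i\<le>n. x i = a i} = path_weight \<nu> 0 n a)"
    using exists_chain_measure[OF \<nu>] by (rule exE)
  then have "P \<in> solutions G T \<phi> \<mu>"
    using chain_noise_independent[OF \<nu>] by (simp add: solutions_iff_independent)
  then show ?thesis by blast
qed

end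

section \<open>The equivalence\<close>

theorem proposition4p3:
  fixes G :: "nat \<Rightarrow> 'a monoid"
    and T :: "nat \<Rightarrow> 'a topology"
    and \<phi> :: "nat \<Rightarrow> 'a \<Rightarrow> 'a"
    and \<mu> :: "nat \<Rightarrow> 'a measure"
  assumes "compact_group_chain G T \<phi> \<mu>"
    and "\<And>k. finite (carrier (G k))"
  shows "((H_det G T \<phi> \<mu> = reps G T \<and> H_freeze G T \<phi> \<mu> = reps G T) \<longleftrightarrow>
            (\<exists>P\<in>solutions G T \<phi> \<mu>. eventually_frozen G \<phi> P)) \<and>
         ((\<exists>P\<in>solutions G T \<phi> \<mu>. eventually_frozen G \<phi> P) \<longleftrightarrow>
            (\<forall>P\<in>solutions G T \<phi> \<mu>. eventually_frozen G \<phi> P))"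
proof -
  interpret finite_group_chain G T \<phi> \<mu>
    using assms by (intro finite_group_chain.intro finite_group_chain_axioms.intro)
  obtain P where "P \<in> solutions G T \<phi> \<mu>" using solutions_nonempty by auto
  then show ?thesis unfolding H_all_iff_concentrates by (auto simp: eventually_frozen_iff)
qed

end
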